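(* Let $G$ be a group equipped with a conjugation-invariant norm and suppose that $G$ has locally bounded commutators. Then: (a) $G$ is independent of scaling. (b) $\|[g]\|_{\hat{\mathcal{C}}(G)}=\lim_{t\to\infty}\tfrac{\|g(t)\|}{t}$ for any $[g]\in\hat{\mathcal{C}}(G)$. (c) $\hat{\mathcal{C}}(G)$ is abelian.
   Context: Norms. A norm on a group $G$ is a function $\|\cdot\|\colon G\to[0,\infty)$ with $\|g\|=0\iff g=1$, $\|g^{-1}\|=\|g\|$ and $\|gh\|\le\|g\|+\|h\|$; for a pseudonorm one only requires $\|1\|=0$ instead of the first condition. It is conjugation-invariant if $\|hgh^{-1}\|=\|g\|$ for all $g,h$. It induces the bi-invariant (pseudo)metric $d(g,h)=\|g^{-1}h\|$; all metric notions refer to it. $G$ has locally bounded commutators if for every finitely generated subgroup $H\le G$ the commutator subgroup $[H,H]$ is a bounded subset of $G$ (with respect to the given norm of $G$). The groups $F_{\mathbb{R}}(G)$ and $F(G)$. $F_{\mathbb{R}}(G)$ is the free product of copies of the additive group $\mathbb{R}$ indexed by the elements $g$ of the set $G$; the element $r$ of the copy indexed by $g$ is written $\overline{g}(r)$. It carries the conjugation-invariant pseudonorm $$\|x\|=\inf\Big\{\sum_{i=1}^n |r_i|\,\|g_i\| : x=\prod_{i=1}^n h_i\,\overline{g_i}(r_i)^{\pm1}h_i^{-1},\ h_i\in F_{\mathbb{R}}(G)\Big\}.$$ $F(G)\le F_{\mathbb{R}}(G)$ is the subgroup generated by the elements $\overline{g}:=\overline{g}(1)$; it is free on $\{\overline{g}: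 g\in G\}$. For $t\in\mathbb{R}$, $\psi_t\colon F_{\mathbb{R}}(G)\to F_{\mathbb{R}}(G)$ is the homomorphism with $\psi_t(\overline{g}(r))=\overline{g}(tr)$. $\pi\colon F(G)\to G$ is the homomorphism with $\pi(\overline{g})=g$. Directional asymptotic cone. A scaling set is an unbounded subset $T\subseteq(0,\infty)$; limits over $t\in T$ are taken as $t\to\infty$. A function $f$ from $T$ to a pseudometric space is Cauchy if for every $\epsilon>0$, $d(f(t),f(t'))<\epsilon$ for all sufficiently large $t,t'\in T$. $\mathcal{D}(G,T)$ is the group (pointwise product) of all functions $w\colon T\to F(G)$ such that $t\mapsto\psi_{1/t}(w(t))\in F_{\mathbb{R}}(G)$ is Cauchy, with pseudonorm $\|w\|=\lim_{t\in T}\|\psi_{1/t}(w(t))\|$. $\mathcal{C}(G,T)=\{\pi\circ w: w\in\mathcal{D}(G,T)\}$, a group of functions $T\to G$, with pseudonorm $\|g\|=\inf\{\|w\|: w\in\mathcal{D}(G,T),\ \pi\circ w=g\}$. The directional asymptotic cone $\hat{\mathcal{C}}(G,T)$ is the quotient of $\mathcal{C}(G,T)$ by the normal subgroup of elements of pseudonorm $0$, with the induced conjugation-invariant norm; $[g]$ denotes the class of $g$. Write $\hat{\mathcal{C}}(G)=\hat{\mathcal{C}}(G,(0,\infty))$. Independence of scaling. For scaling sets $T\subseteq T'$ there is a well-defined homomorphism $\hat{\mathcal{C}}(G,T')\to\hat{\mathcal{C}}(G,T)$, $[g]\mapsto[g|_T]$. $G$ is independent of scaling if this is an isometry for all scaling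 sets $T\subseteq T'$. *)

theory Defs
  imports Complex_Main "HOL-Algebra.Product_Groups"
begin

section \<open>Norms on groups\<close>

definition group_norm :: "('a, 'b) monoid_scheme \<Rightarrow> ('a \<Rightarrow> real) \<Rightarrow> bool" where
  "group_norm G N \<longleftrightarrow>
     (\<forall>x\<in>carrier G. 0 \<le> N x \<and> (N x = 0 \<longleftrightarrow> x = \<one>\<^bsub>G\<^esub>) \<and> N (inv\<^bsub>G\<^esub> x) = N x) \<and>
     (\<forall>x\<in>carrier G. \<forall>y\<in>carrier G. N (x \<otimes>\<^bsub>G\<^esub> y) \<le> N x + N y)"

definition conj_invariant :: "('a, 'b) monoid_scheme \<Rightarrow> ('a \<Rightarrow> real) \<Rightarrow> bool" where
  "conj_invariant G N \<longleftrightarrow>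
     (\<forall>g\<in>carrier G. \<forall>h\<in>carrier G. N (h \<otimes>\<^bsub>G\<^esub> g \<otimes>\<^bsub>G\<^esub> inv\<^bsub>G\<^esub> h) = N g)"

definition norm_dist :: "('a, 'b) monoid_scheme \<Rightarrow> ('a \<Rightarrow> real) \<Rightarrow> 'a \<Rightarrow> 'a \<Rightarrow> real" where
  "norm_dist G N g h = N (inv\<^bsub>G\<^esub> g \<otimes>\<^bsub>G\<^esub> h)"

definition norm_bounded :: "('a, 'b) monoid_scheme \<Rightarrow> ('a \<Rightarrow> real) \<Rightarrow> 'a set \<Rightarrow> bool" where
  "norm_bounded G N S \<longleftrightarrow> (\<exists>B. \<forall>x\<in>S. \<forall>y\<in>S. norm_dist G N x y \<le> B)"

definition locally_bounded_commutators :: "('a, 'b) monoid_scheme \<Rightarrow> ('a \<Rightarrow> real) \<Rightarrow> bool" where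
  "locally_bounded_commutators G N \<longleftrightarrow>
     (\<forall>S. finite S \<and> S \<subseteq> carrier G \<longrightarrow> norm_bounded G N (derived G (generate G S)))"


section \<open>The free product of copies of the reals\<close>

text \<open>
  Elements of the free product of copies of \<open>(\<real>, +)\<close> indexed by a set \<open>I\<close> are represented by
  their normal forms: lists of letters \<open>(g, r)\<close>, where \<open>g \<in> I\<close> names the copy and \<open>r \<noteq> 0\<close> is the
  element of it, in which neighbouring letters belong to different copies. The function
  \<open>letter_mult\<close> multiplies a normal form by an element of one copy from the left.
\<close>

fun letter_mult :: "'a \<times> real \<Rightarrow> ('a \<times> real) list \<Rightarrow> ('a \<times> real) list" where
  "letter_mult (g, r) [] = (if r = 0 then [] else [(g, r)])"
| "letter_mult (g, r) ((h, s) # w) =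
     (if r = 0 then (h, s) # w
      else if g \<noteq> h then (g, r) # (h, s) # w
      else if r + s = 0 then w
      else (g, r + s) # w)"

definition real_free_product :: "'a set \<Rightarrow> ('a \<times> real) list monoid" where
  "real_free_product I =
     \<lparr>carrier = {w. set w \<subseteq> I \<times> (- {0}) \<and> successively (\<lambda>x y. fst x \<noteq> fst y) w},
      monoid.mult = (\<lambda>u v. foldr letter_mult u v),
      one = []\<rparr>"

definition free_letter :: "'a \<Rightarrow> real \<Rightarrow> ('a \<times> real) list" where
  "free_letter g r = letter_mult (g, r) []"

text \<open>
  The homomorphism out of the free product (or a subgroup of it) given by \<open>f g r\<close> on the element
  \<open>r\<close> of the copy indexed by \<open>g\<close>; see the lemmas \<open>free_lift_mult\<close> and \<open>free_lift_letter\<close>.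
\<close>

definition free_lift ::
    "('c, 'd) monoid_scheme \<Rightarrow> ('a \<Rightarrow> real \<Rightarrow> 'c) \<Rightarrow> ('a \<times> real) list \<Rightarrow> 'c" where
  "free_lift H f w = foldr (\<lambda>(g, r) x. f g r \<otimes>\<^bsub>H\<^esub> x) w \<one>\<^bsub>H\<^esub>"

context
  fixes I :: "'a set"
begin

lemma carrier_Cons:
  "(g, r) # w \<in> carrier (real_free_product I) \<longleftrightarrow>
     g \<in> I \<and> r \<noteq> 0 \<and> w \<in> carrier (real_free_product I) \<and> (w = [] \<or> g \<noteq> fst (hd w))"
  by (auto simp: real_free_product_def successively_Cons)

lemma carrier_Nil: "[] \<in> carrier (real_free_product I)"
  by (simp add: real_free_product_def)

lemma letter_mult_closed:
  assumes "g \<in> I" "w \<in> carrier (real_free_product I)"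
  shows "letter_mult (g, r) w \<in> carrier (real_free_product I)"
  using assms by (cases w) (auto simp: carrier_Cons carrier_Nil)

lemma letter_mult_add:
  assumes "w \<in> carrier (real_free_product I)"
  shows "letter_mult (g, r) (letter_mult (g, s) w) = letter_mult (g, r + s) w"
proof (cases w)
  case Nil
  then show ?thesis by auto
next
  case (Cons x v)
  obtain h q where x: "x = (h, q)" by (cases x)
  show ?thesis
  proof (cases v)
    case Nil
    then show ?thesis using Cons x assms by (auto simp: carrier_Cons algebra_simps)
  next
    case (Cons y u)
    obtain h' q' where y: "y = (h', q')" by (cases y)
    show ?thesis
      using Cons y \<open>w = x # v\<close> x assms by (auto simp: carrier_Cons algebra_simps)
  qed
qed

lemma letter_mult_zero: "letter_mult (g, 0) w = w"
  by (cases w) auto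

lemma letter_mult_carrier:
  "(g, r) # w \<in> carrier (real_free_product I) \<Longrightarrow> letter_mult (g, r) w = (g, r) # w"
  by (cases w) (auto simp: carrier_Cons)

lemma mult_real_free_product:
  "u \<otimes>\<^bsub>real_free_product I\<^esub> v = foldr letter_mult u v"
  by (simp add: real_free_product_def)

lemma one_real_free_product: "\<one>\<^bsub>real_free_product I\<^esub> = []"
  by (simp add: real_free_product_def)

lemma foldr_letter_closed:
  assumes "set u \<subseteq> I \<times> UNIV" "v \<in> carrier (real_free_product I)"
  shows "foldr letter_mult u v \<in> carrier (real_free_product I)"
  using assms by (induction u) (auto intro: letter_mult_closed)

lemma carrier_letters:
  "u \<in> carrier (real_free_product I) \<Longrightarrow> set u \<subseteq> I \<times> UNIV"
  by (auto simp: real_free_product_def)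

lemma foldr_letter_mult:
  assumes "u \<in> carrier (real_free_product I)" "v \<in> carrier (real_free_product I)"
  shows "foldr letter_mult (letter_mult (g, r) u) v = letter_mult (g, r) (foldr letter_mult u v)"
proof (cases u)
  case Nil
  then show ?thesis by (simp add: letter_mult_zero)
next
  case (Cons x w)
  obtain h s where x: "x = (h, s)" by (cases x)
  have w: "foldr letter_mult w v \<in> carrier (real_free_product I)"
    using assms Cons carrier_letters[of u] by (intro foldr_letter_closed) auto
  show ?thesis
    using Cons x letter_mult_add[OF w, of g r s] by (auto simp: letter_mult_zero)
qed

lemma foldr_letter_assoc:
  assumes "set u \<subseteq> I \<times> UNIV" "v \<in> carrier (real_free_product I)"
    "w \<in> carrier (real_free_product I)"
  shows "foldr letter_mult (foldr letter_mult u v) w = foldr letter_mult u (foldr letter_mult v w)"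
  using assms
proof (induction u)
  case Nil
  then show ?case by simp
next
  case (Cons x u)
  obtain g r where x: "x = (g, r)" by (cases x)
  show ?case
    using Cons x foldr_letter_mult[OF foldr_letter_closed, of u v w g r] by simp
qed

lemma foldr_letter_self:
  "u \<in> carrier (real_free_product I) \<Longrightarrow> foldr letter_mult u [] = u"
proof (induction u)
  case Nil
  then show ?case by simp
next
  case (Cons x u)
  obtain g r where x: "x = (g, r)" by (cases x)
  show ?case
    using Cons x letter_mult_carrier[of g r u] by (simp add: carrier_Cons)
qed

lemma foldr_letter_inverse:
  assumes "set u \<subseteq> I \<times> UNIV" "v \<in> carrier (real_free_product I)"
  shows "foldr letter_mult (rev (map (\<lambda>(g, r). (g, - r)) u)) (foldr letter_mult u v) = v"
  using assms
proof (induction u)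
  case Nil
  then show ?case by simp
next
  case (Cons x u)
  obtain g r where x: "x = (g, r)" by (cases x)
  have "foldr letter_mult u v \<in> carrier (real_free_product I)"
    using Cons by (intro foldr_letter_closed) auto
  then show ?case
    using Cons x letter_mult_add[of "foldr letter_mult u v" g "- r" r]
    by (simp add: letter_mult_zero)
qed

lemma group_real_free_product: "group (real_free_product I)"
proof (rule groupI)
  fix x y assume xy: "x \<in> carrier (real_free_product I)" "y \<in> carrier (real_free_product I)"
  show "x \<otimes>\<^bsub>real_free_product I\<^esub> y \<in> carrier (real_free_product I)"
    unfolding mult_real_free_product using xy by (intro foldr_letter_closed carrier_letters)
next
  show "\<one>\<^bsub>real_free_product I\<^esub> \<in> carrier (real_free_product I)"
    by (simp add: one_real_free_product carrier_Nil)
next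
  fix x y z
  assume "x \<in> carrier (real_free_product I)" "y \<in> carrier (real_free_product I)"
    "z \<in> carrier (real_free_product I)"
  then show "x \<otimes>\<^bsub>real_free_product I\<^esub> y \<otimes>\<^bsub>real_free_product I\<^esub> z =
      x \<otimes>\<^bsub>real_free_product I\<^esub> (y \<otimes>\<^bsub>real_free_product I\<^esub> z)"
    unfolding mult_real_free_product by (intro foldr_letter_assoc carrier_letters)
next
  fix x assume x: "x \<in> carrier (real_free_product I)"
  then show "\<one>\<^bsub>real_free_product I\<^esub> \<otimes>\<^bsub>real_free_product I\<^esub> x = x"
    by (simp add: mult_real_free_product one_real_free_product)
  let ?u = "map (\<lambda>(g, r). (g, - r)) x"
  have c: "rev ?u \<in> carrier (real_free_product I)"
    using x by (auto simp: real_free_product_def successively_map case_prod_beta neq_commute)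
  have "rev ?u \<otimes>\<^bsub>real_free_product I\<^esub> x = foldr letter_mult (rev ?u) (foldr letter_mult x [])"
    using x by (simp add: mult_real_free_product foldr_letter_self)
  also have "\<dots> = []"
    using x by (intro foldr_letter_inverse) (auto simp: carrier_letters carrier_Nil)
  finally show "\<exists>y\<in>carrier (real_free_product I).
      y \<otimes>\<^bsub>real_free_product I\<^esub> x = \<one>\<^bsub>real_free_product I\<^esub>"
    using c one_real_free_product by metis
qed

lemma free_letter_closed: "g \<in> I \<Longrightarrow> free_letter g r \<in> carrier (real_free_product I)"
  unfolding free_letter_def by (intro letter_mult_closed carrier_Nil)

lemma free_letter_add:
  "free_letter g r \<otimes>\<^bsub>real_free_product I\<^esub> free_letter g s = free_letter g (r + s)"
  by (auto simp: free_letter_def mult_real_free_product)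

lemma free_letter_inv:
  assumes "g \<in> I"
  shows "inv\<^bsub>real_free_product I\<^esub> (free_letter g r) = free_letter g (- r)"
  using assms free_letter_add[of g "- r" r]
  by (intro group.inv_equality[OF group_real_free_product])
     (auto simp: one_real_free_product free_letter_closed, simp add: free_letter_def)

lemma free_lift_letters:
  assumes "w \<in> carrier (real_free_product I)"
  shows "free_lift (real_free_product I) free_letter w = w"
  using assms
proof (induction w)
  case Nil
  then show ?case by (simp add: free_lift_def one_real_free_product)
next
  case (Cons x w)
  obtain g r where x: "x = (g, r)" by (cases x)
  show ?case
    using Cons x letter_mult_carrier[of g r w]
    by (auto simp: free_lift_def carrier_Cons mult_real_free_product free_letter_def)
qed

context
  fixes H :: "('c, 'd) monoid_scheme" and f :: "'a \<Rightarrow> real \<Rightarrow> 'c" and A :: "real set"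
  assumes H: "group H"
    and f: "\<And>g r. g \<in> I \<Longrightarrow> r \<in> A \<Longrightarrow> f g r \<in> carrier H"
    and f_add: "\<And>g r s. g \<in> I \<Longrightarrow> r \<in> A \<Longrightarrow> s \<in> A \<Longrightarrow> f g (r + s) = f g r \<otimes>\<^bsub>H\<^esub> f g s"
begin

interpretation H: group H by (rule H)

lemma f_zero: "g \<in> I \<Longrightarrow> 0 \<in> A \<Longrightarrow> f g 0 = \<one>\<^bsub>H\<^esub>"
  using f[of g 0] f_add[of g 0 0] by (metis H.r_cancel_one add.right_neutral)

lemma free_lift_letter:
  assumes "g \<in> I" "0 \<in> A" "r \<in> A"
  shows "free_lift H f (free_letter g r) = f g r"
  using assms f f_zero by (auto simp: free_lift_def free_letter_def)

lemma free_lift_closed: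
  "set w \<subseteq> I \<times> A \<Longrightarrow> free_lift H f w \<in> carrier H"
  by (induction w) (auto simp: free_lift_def f)

lemma free_lift_letter_mult:
  assumes "0 \<in> A" "g \<in> I" "r \<in> A" "set w \<subseteq> I \<times> A"
  shows "free_lift H f (letter_mult (g, r) w) = f g r \<otimes>\<^bsub>H\<^esub> free_lift H f w"
proof (cases w)
  case Nil
  then show ?thesis using assms f_zero f by (auto simp: free_lift_def)
next
  case (Cons x v)
  obtain h s where x: "x = (h, s)" by (cases x)
  have v: "free_lift H f v \<in> carrier H" and s: "s \<in> A" "h \<in> I"
    using Cons x assms free_lift_closed[of v] by auto
  have w: "free_lift H f ((k, q) # v) = f k q \<otimes>\<^bsub>H\<^esub> free_lift H f v" for k q
    by (simp add: free_lift_def)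
  have w': "free_lift H f ((k, q) # (h, s) # v) = f k q \<otimes>\<^bsub>H\<^esub> (f h s \<otimes>\<^bsub>H\<^esub> free_lift H f v)" for k q
    by (simp add: free_lift_def)
  have add: "f g r \<otimes>\<^bsub>H\<^esub> (f g s \<otimes>\<^bsub>H\<^esub> free_lift H f v) = f g (r + s) \<otimes>\<^bsub>H\<^esub> free_lift H f v"
    using assms s v f f_add by (simp add: H.m_assoc)
  show ?thesis
  proof (cases "r = 0")
    case True
    then show ?thesis using assms f_zero free_lift_closed[of w] by (simp add: Cons x)
  next
    case nz: False
    show ?thesis
    proof (cases "g = h")
      case True
      show ?thesis
      proof (cases "r + s = 0")
        case True
        then show ?thesis
          using nz \<open>g = h\<close> add w assms f_zero v by (simp add: Cons x)
      next
        case False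
        then show ?thesis using nz \<open>g = h\<close> add w by (simp add: Cons x)
      qed
    next
      case False
      then show ?thesis using nz w w' by (simp add: Cons x)
    qed
  qed
qed

lemma letter_mult_exponents:
  assumes "\<And>r s. r \<in> A \<Longrightarrow> s \<in> A \<Longrightarrow> r + s \<in> A" "g \<in> I" "r \<in> A" "set w \<subseteq> I \<times> A"
  shows "set (letter_mult (g, r) w) \<subseteq> I \<times> A"
  using assms by (cases w) (auto split: if_splits)

lemma free_lift_mult:
  assumes A: "0 \<in> A" "\<And>r s. r \<in> A \<Longrightarrow> s \<in> A \<Longrightarrow> r + s \<in> A"
    and "set u \<subseteq> I \<times> A" "set v \<subseteq> I \<times> A"
  shows "set (u \<otimes>\<^bsub>real_free_product I\<^esub> v) \<subseteq> I \<times> A \<and>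
    free_lift H f (u \<otimes>\<^bsub>real_free_product I\<^esub> v) = free_lift H f u \<otimes>\<^bsub>H\<^esub> free_lift H f v"
  using assms(3)
proof (induction u)
  case Nil
  then show ?case
    using assms free_lift_closed[of v] by (simp add: mult_real_free_product) (simp add: free_lift_def)
next
  case (Cons x u)
  obtain g r where x: "x = (g, r)" by (cases x)
  have gr: "g \<in> I" "r \<in> A" and u: "set u \<subseteq> I \<times> A"
    using Cons.prems x by auto
  have IH: "set (foldr letter_mult u v) \<subseteq> I \<times> A"
    "free_lift H f (foldr letter_mult u v) = free_lift H f u \<otimes>\<^bsub>H\<^esub> free_lift H f v"
    using Cons.IH[OF u] by (simp_all add: mult_real_free_product)
  have "free_lift H f (x # u) = f g r \<otimes>\<^bsub>H\<^esub> free_lift H f u"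
    by (simp add: free_lift_def x)
  then show ?case
    using x gr IH free_lift_letter_mult[OF A(1) gr IH(1)] letter_mult_exponents[OF A(2) gr IH(1)]
      free_lift_closed[OF u] free_lift_closed[OF assms(4)] f[OF gr]
    by (simp add: mult_real_free_product H.m_assoc)
qed

end

end


section \<open>The groups \<open>F\<^sub>\<real>(G)\<close> and \<open>F(G)\<close>\<close>

abbreviation FR :: "('a, 'b) monoid_scheme \<Rightarrow> ('a \<times> real) list monoid" where
  "FR G \<equiv> real_free_product (carrier G)"

definition FZ :: "('a, 'b) monoid_scheme \<Rightarrow> ('a \<times> real) list monoid" where
  "FZ G = (FR G)\<lparr>carrier := generate (FR G) ((\<lambda>g. free_letter g 1) ` carrier G)\<rparr>"

definition free_norm ::
    "('a, 'b) monoid_scheme \<Rightarrow> ('a \<Rightarrow> real) \<Rightarrow> ('a \<times> real) list \<Rightarrow> real" where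
  "free_norm G N x = Inf {(\<Sum>i<n. \<bar>r i\<bar> * N (g i)) | (n::nat) r g h (e :: nat \<Rightarrow> int).
     (\<forall>i<n. g i \<in> carrier G \<and> h i \<in> carrier (FR G) \<and> e i \<in> {1, -1}) \<and>
     x = foldr (\<otimes>\<^bsub>FR G\<^esub>)
           (map (\<lambda>i. h i \<otimes>\<^bsub>FR G\<^esub> (free_letter (g i) (r i) [^]\<^bsub>FR G\<^esub> e i) \<otimes>\<^bsub>FR G\<^esub> inv\<^bsub>FR G\<^esub> h i) [0..<n])
           \<one>\<^bsub>FR G\<^esub>}"

definition psi ::
    "('a, 'b) monoid_scheme \<Rightarrow> real \<Rightarrow> ('a \<times> real) list \<Rightarrow> ('a \<times> real) list" where
  "psi G t = free_lift (FR G) (\<lambda>g r. free_letter g (t * r))"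

text \<open>
  The homomorphism \<open>\<pi>\<close>. All letters of an element of \<open>F(G)\<close> have integer exponents (lemma
  \<open>FZ_exponents\<close>), so that the rounding is vacuous on \<open>F(G)\<close>; see \<open>free_proj_hom\<close> and \<open>free_proj_letter\<close>.
\<close>

definition free_proj :: "('a, 'b) monoid_scheme \<Rightarrow> ('a \<times> real) list \<Rightarrow> 'a" where
  "free_proj G = free_lift G (\<lambda>g r. g [^]\<^bsub>G\<^esub> \<lfloor>r\<rfloor>)"

lemma psi_hom: "psi G t \<in> hom (FR G) (FR G)"
proof (rule homI)
  have 1: "\<And>g r. g \<in> carrier G \<Longrightarrow> r \<in> UNIV \<Longrightarrow> free_letter g (t * r) \<in> carrier (FR G)"
    by (rule free_letter_closed)
  have 2: "\<And>g r s. g \<in> carrier G \<Longrightarrow> r \<in> UNIV \<Longrightarrow> s \<in> UNIV \<Longrightarrow>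
      free_letter g (t * (r + s)) = free_letter g (t * r) \<otimes>\<^bsub>FR G\<^esub> free_letter g (t * s)"
    by (simp add: free_letter_add distrib_left)
  fix x y assume x: "x \<in> carrier (FR G)" and y: "y \<in> carrier (FR G)"
  show "psi G t x \<in> carrier (FR G)"
    unfolding psi_def
    by (rule free_lift_closed[OF group_real_free_product 1 2 carrier_letters[OF x]])
  show "psi G t (x \<otimes>\<^bsub>FR G\<^esub> y) = psi G t x \<otimes>\<^bsub>FR G\<^esub> psi G t y"
    unfolding psi_def
    using free_lift_mult[where f = "\<lambda>g r. free_letter g (t * r)" and A = UNIV,
        OF group_real_free_product 1 2 _ _ carrier_letters[OF x] carrier_letters[OF y]]
    by simp
qed

lemma psi_letter: "psi G t (free_letter g r) = free_letter g (t * r)"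
  by (auto simp: psi_def free_lift_def free_letter_def mult_real_free_product one_real_free_product)

lemma FZ_exponents:
  assumes "w \<in> carrier (FZ G)"
  shows "set w \<subseteq> carrier G \<times> \<int>"
proof -
  have *: "set (foldr letter_mult u v) \<subseteq> carrier G \<times> \<int>"
    if "set u \<subseteq> carrier G \<times> \<int>" "set v \<subseteq> carrier G \<times> \<int>" for u v
    using that(1)
  proof (induction u)
    case (Cons x u)
    then show ?case
      by (cases x; cases "foldr letter_mult u v") (auto split: if_splits)
  qed (use that(2) in simp)
  have "w \<in> generate (FR G) ((\<lambda>g. free_letter g 1) ` carrier G)"
    using assms by (simp add: FZ_def)
  then show ?thesis
  proof (induction rule: generate.induct)
    case one
    then show ?case by (simp add: one_real_free_product)
  next
    case (incl h)
    then show ?case by (auto simp: free_letter_def)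
  next
    case (inv h)
    then obtain g where g: "g \<in> carrier G" "h = free_letter g 1" by auto
    have "inv\<^bsub>FR G\<^esub> h = free_letter g (-1)"
      using free_letter_inv[OF g(1), of 1] g(2) by simp
    then show ?case using g(1) by (auto simp: free_letter_def)
  next
    case (eng u v)
    then show ?case unfolding mult_real_free_product by (intro *)
  qed
qed

lemma free_proj_hom:
  assumes "group G"
  shows "free_proj G \<in> hom (FZ G) G"
proof (rule homI)
  interpret group G by fact
  have 1: "\<And>g r. g \<in> carrier G \<Longrightarrow> r \<in> \<int> \<Longrightarrow> g [^]\<^bsub>G\<^esub> \<lfloor>r\<rfloor> \<in> carrier G"
    by simp
  have 2: "\<And>g r s. g \<in> carrier G \<Longrightarrow> r \<in> \<int> \<Longrightarrow> s \<in> \<int> \<Longrightarrow>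
      g [^]\<^bsub>G\<^esub> \<lfloor>r + s :: real\<rfloor> = g [^]\<^bsub>G\<^esub> \<lfloor>r\<rfloor> \<otimes>\<^bsub>G\<^esub> g [^]\<^bsub>G\<^esub> \<lfloor>s\<rfloor>"
    by (auto elim!: Ints_cases simp: int_pow_mult simp flip: of_int_add)
  fix x y assume x: "x \<in> carrier (FZ G)" and y: "y \<in> carrier (FZ G)"
  show "free_proj G x \<in> carrier G"
    unfolding free_proj_def
    by (rule free_lift_closed[OF assms 1 2 FZ_exponents[OF x]])
  have "x \<otimes>\<^bsub>FZ G\<^esub> y = x \<otimes>\<^bsub>FR G\<^esub> y"
    by (simp add: FZ_def)
  then show "free_proj G (x \<otimes>\<^bsub>FZ G\<^esub> y) = free_proj G x \<otimes>\<^bsub>G\<^esub> free_proj G y"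
    unfolding free_proj_def
    using free_lift_mult[where f = "\<lambda>g r. g [^]\<^bsub>G\<^esub> \<lfloor>r\<rfloor>" and A = \<int>,
        OF assms 1 2 _ _ FZ_exponents[OF x] FZ_exponents[OF y]] by simp
qed

lemma free_proj_letter:
  assumes "group G" "g \<in> carrier G"
  shows "free_proj G (free_letter g 1) = g"
proof -
  interpret group G by fact
  show ?thesis using assms(2) by (simp add: free_proj_def free_lift_def free_letter_def)
qed


section \<open>Directional asymptotic cones\<close>

definition scaling_set :: "real set \<Rightarrow> bool" where
  "scaling_set T \<longleftrightarrow> T \<subseteq> {0<..} \<and> \<not> bdd_above T"

definition at_top_in :: "real set \<Rightarrow> real filter" where
  "at_top_in T = inf at_top (principal T)"

definition cauchy_along :: "real set \<Rightarrow> ('x \<Rightarrow> 'x \<Rightarrow> real) \<Rightarrow> (real \<Rightarrow> 'x) \<Rightarrow> bool" where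
  "cauchy_along T d f \<longleftrightarrow>
     (\<forall>\<epsilon>>0. \<exists>s. \<forall>t\<in>T. \<forall>t'\<in>T. s \<le> t \<and> s \<le> t' \<longrightarrow> d (f t) (f t') < \<epsilon>)"

text \<open>Functions on \<open>T\<close> are represented by total functions with value \<open>undefined\<close> outside \<open>T\<close>.\<close>

definition dir_group ::
    "('a, 'b) monoid_scheme \<Rightarrow> ('a \<Rightarrow> real) \<Rightarrow> real set \<Rightarrow> (real \<Rightarrow> ('a \<times> real) list) monoid" where
  "dir_group G N T = (product_group T (\<lambda>_. FZ G))
     \<lparr>carrier := {w \<in> (\<Pi>\<^sub>E t\<in>T. carrier (FZ G)).
        cauchy_along T (norm_dist (FR G) (free_norm G N)) (\<lambda>t. psi G (1 / t) (w t))}\<rparr>"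

definition dir_norm ::
    "('a, 'b) monoid_scheme \<Rightarrow> ('a \<Rightarrow> real) \<Rightarrow> real set \<Rightarrow> (real \<Rightarrow> ('a \<times> real) list) \<Rightarrow> real" where
  "dir_norm G N T w = Lim (at_top_in T) (\<lambda>t. free_norm G N (psi G (1 / t) (w t)))"

definition fun_group ::
    "('a, 'b) monoid_scheme \<Rightarrow> ('a \<Rightarrow> real) \<Rightarrow> real set \<Rightarrow> (real \<Rightarrow> 'a) monoid" where
  "fun_group G N T = (product_group T (\<lambda>_. G))
     \<lparr>carrier := (\<lambda>w. \<lambda>t\<in>T. free_proj G (w t)) ` carrier (dir_group G N T)\<rparr>"

definition fun_norm ::
    "('a, 'b) monoid_scheme \<Rightarrow> ('a \<Rightarrow> real) \<Rightarrow> real set \<Rightarrow> (real \<Rightarrow> 'a) \<Rightarrow> real" where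
  "fun_norm G N T g = Inf {dir_norm G N T w | w.
     w \<in> carrier (dir_group G N T) \<and> (\<lambda>t\<in>T. free_proj G (w t)) = g}"

definition null_subgroup ::
    "('a, 'b) monoid_scheme \<Rightarrow> ('a \<Rightarrow> real) \<Rightarrow> real set \<Rightarrow> (real \<Rightarrow> 'a) set" where
  "null_subgroup G N T = {g \<in> carrier (fun_group G N T). fun_norm G N T g = 0}"

definition dir_cone ::
    "('a, 'b) monoid_scheme \<Rightarrow> ('a \<Rightarrow> real) \<Rightarrow> real set \<Rightarrow> (real \<Rightarrow> 'a) set monoid" where
  "dir_cone G N T = fun_group G N T Mod null_subgroup G N T"

definition cone_class ::
    "('a, 'b) monoid_scheme \<Rightarrow> ('a \<Rightarrow> real) \<Rightarrow> real set \<Rightarrow> (real \<Rightarrow> 'a) \<Rightarrow> (real \<Rightarrow> 'a) set" where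
  "cone_class G N T g = null_subgroup G N T #>\<^bsub>fun_group G N T\<^esub> g"

text \<open>
  The norm and the restriction map are induced on classes: \<^const>\<open>the_elem\<close> selects the common
  value on all representatives of a class.
\<close>

definition cone_norm ::
    "('a, 'b) monoid_scheme \<Rightarrow> ('a \<Rightarrow> real) \<Rightarrow> real set \<Rightarrow> (real \<Rightarrow> 'a) set \<Rightarrow> real" where
  "cone_norm G N T X = the_elem (fun_norm G N T ` X)"

definition cone_restrict ::
    "('a, 'b) monoid_scheme \<Rightarrow> ('a \<Rightarrow> real) \<Rightarrow> real set \<Rightarrow> (real \<Rightarrow> 'a) set \<Rightarrow> (real \<Rightarrow> 'a) set" where
  "cone_restrict G N T X = the_elem ((\<lambda>g. cone_class G N T (restrict g T)) ` X)"

definition isometry_between ::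
    "'x set \<Rightarrow> ('x \<Rightarrow> 'x \<Rightarrow> real) \<Rightarrow> 'y set \<Rightarrow> ('y \<Rightarrow> 'y \<Rightarrow> real) \<Rightarrow> ('x \<Rightarrow> 'y) \<Rightarrow> bool" where
  "isometry_between X d Y d' f \<longleftrightarrow>
     bij_betw f X Y \<and> (\<forall>x\<in>X. \<forall>y\<in>X. d' (f x) (f y) = d x y)"

definition independent_of_scaling :: "('a, 'b) monoid_scheme \<Rightarrow> ('a \<Rightarrow> real) \<Rightarrow> bool" where
  "independent_of_scaling G N \<longleftrightarrow>
     (\<forall>T T'. scaling_set T \<and> scaling_set T' \<and> T \<subseteq> T' \<longrightarrow>
        isometry_between
          (carrier (dir_cone G N T')) (norm_dist (dir_cone G N T') (cone_norm G N T'))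
          (carrier (dir_cone G N T)) (norm_dist (dir_cone G N T) (cone_norm G N T))
          (cone_restrict G N T))"

end

theory Submission
  imports Defs
begin

text \<open>
  All three parts follow from one formula, valid for every scaling set \<open>T\<close>: for \<open>g\<close> in \<open>\<C>(G,T)\<close> the
  number \<open>\<parallel>g\<parallel>\<close>, an infimum over all lifts of \<open>g\<close> to \<open>\<D>(G,T)\<close>, is the limit of \<open>N (g t) / t\<close> along \<open>T\<close>
  (lemma \<open>fun_norm_tendsto\<close>). Such a limit stays the same when \<open>T\<close> is made smaller, so restriction
  preserves norms; for \<open>T = (0, \<infinity>)\<close> it is the asserted growth rate; and the cone is abelian as soon as
  the norms of the commutators of two elements of \<open>\<C>(G,T)\<close> grow more slowly than \<open>t\<close>.

  The limit is at most \<open>\<parallel>g\<parallel>\<close> because \<open>\<pi>\<close> does not increase norms, although the norm of \<open>v \<in> F(G)\<close> in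
  \<open>F\<^sub>\<real>(G)\<close> may use fractional exponents and arbitrary conjugators (lemma \<open>norm_free_proj_le\<close>). The
  reason is combinatorial: the norm of \<open>x \<in> F\<^sub>\<real>(G)\<close> is the least cost of collapsing the word \<open>x\<close> to
  the empty word, where deleting a letter \<open>(g, r)\<close> costs \<open>\<bar>r\<bar> * N g\<close> and merging two neighbouring
  letters with the same name is free. Both moves preserve integrality of the exponents, so a collapse
  of a word with integral exponents can be imitated in \<open>G\<close>.

  For the converse inequality, the Cauchy condition approximates a lift of \<open>g\<close> by the rounded words
  with letters \<open>(g\<^sub>j, \<lfloor>t * r\<^sub>j\<rfloor>)\<close> of one element \<open>x\<close> of \<open>F\<^sub>\<real>(G)\<close> with letters \<open>(g\<^sub>j, r\<^sub>j)\<close>. Let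
  \<open>p t\<close> be the product of the powers of the \<open>g\<^sub>j\<close> with these exponents, and fix \<open>s > 0\<close>. In the subgroup
  \<open>H\<close> generated by the \<open>g\<^sub>j\<close>, modulo \<open>[H, H]\<close>, the element \<open>p t\<close> is the power of \<open>p s\<close> with exponent
  \<open>\<lfloor>t / s\<rfloor>\<close> times powers of the \<open>g\<^sub>j\<close> whose exponents are of order at most \<open>t / s\<close>. The factor in
  \<open>[H, H]\<close> is bounded and does not count after division by \<open>t\<close>. Lifting \<open>p s\<close> to the single letter
  named \<open>p s\<close> therefore gives a lift of \<open>p\<close> of norm at most \<open>N (p s) / s + c / s\<close>, where \<open>c\<close> is
  the sum of the \<open>N g\<^sub>j\<close> (lemma \<open>lift_int_words\<close>); now let \<open>s\<close> tend to infinity. The same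
  approximation bounds commutators (lemma \<open>commutator_negligible\<close>).

  Finally, restriction from \<open>T'\<close> to \<open>T\<close> is onto already at the level of \<open>\<D>\<close>: a Cauchy path on \<open>T\<close>
  is continued to \<open>T'\<close> by rounded words that approximate its later values
  (lemma \<open>dir_group_extend\<close>).
\<close>

section \<open>Collapsing words\<close>

text \<open>
  The relation \<open>collapses N I w c\<close> says that \<open>w\<close> can be reduced to the empty word at cost at most \<open>c\<close>.
  Each rule undoes one move, with the exponents of the shorter word as parameters; any letter may be
  deleted and any two equal neighbours merged, so that a step can be performed inside every context.
\<close>
inductive collapses :: "('a \<Rightarrow> real) \<Rightarrow> 'a set \<Rightarrow> ('a \<times> real) list \<Rightarrow> real \<Rightarrow> bool"
  for N :: "'a \<Rightarrow> real" and I :: "'a set" where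
  empty: "0 \<le> c \<Longrightarrow> collapses N I [] c"
| delete: "collapses N I (x @ y) c \<Longrightarrow> g \<in> I \<Longrightarrow> collapses N I (x @ (g, r) # y) (c + \<bar>r\<bar> * N g)"
| merge: "collapses N I (x @ (g, r + s) # y) c \<Longrightarrow> collapses N I (x @ (g, r) # (g, s) # y) c"

lemma collapses_mono: "collapses N I w c \<Longrightarrow> c \<le> d \<Longrightarrow> collapses N I w d"
proof (induction arbitrary: d rule: collapses.induct)
  case (delete x y c g r)
  have "collapses N I (x @ y) (d - \<bar>r\<bar> * N g)"
    using delete by auto
  from collapses.delete[OF this \<open>g \<in> I\<close>, of r] show ?case by simp
qed (auto intro: collapses.intros)

text \<open>
  A factor can be collapsed first, inside its context; subadditivity of the norm and its
  invariance under conjugation come from this.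
\<close>
lemma collapses_insert:
  assumes "collapses N I w d" "collapses N I (x @ y) c"
  shows "collapses N I (x @ w @ y) (c + d)"
  using assms
proof (induction rule: collapses.induct)
  case (empty d)
  then show ?case by (auto intro: collapses_mono)
next
  case (delete x' y' d g r)
  have "collapses N I ((x @ x') @ (g, r) # (y' @ y)) ((c + d) + \<bar>r\<bar> * N g)"
    by (rule collapses.delete) (use delete in auto)
  then show ?case by (simp add: algebra_simps)
next
  case (merge x' g r s y' d)
  have "collapses N I ((x @ x') @ (g, r) # (g, s) # (y' @ y)) (c + d)"
    by (rule collapses.merge) (use merge in auto)
  then show ?case by simp
qed

lemma collapses_append:
  "collapses N I u c \<Longrightarrow> collapses N I v d \<Longrightarrow> collapses N I (u @ v) (c + d)"
  using collapses_insert[of N I v d u "[]" c] by simp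

lemma collapses_letter: "g \<in> I \<Longrightarrow> collapses N I [(g, r)] (\<bar>r\<bar> * N g)"
  using collapses.delete[of N I "[]" "[]" 0 g r] by (simp add: collapses.empty)

lemma collapses_cost:
  "set w \<subseteq> I \<times> UNIV \<Longrightarrow> collapses N I w (\<Sum>(g, r)\<leftarrow>w. \<bar>r\<bar> * N g)"
proof (induction w)
  case (Cons x w)
  obtain g r where x: "x = (g, r)" by (cases x)
  show ?case
    using collapses_append[OF collapses_letter[of g I N r], of w] Cons x by simp
qed (simp add: collapses.empty)

lemma collapses_nonneg:
  assumes "\<And>g. g \<in> I \<Longrightarrow> 0 \<le> N g" "collapses N I w c" shows "0 \<le> c"
  using assms(2) by (induction rule: collapses.induct) (simp_all add: assms(1))

lemma collapses_scale:
  "collapses N I w c \<Longrightarrow> collapses N I (map (\<lambda>(g, r). (g, t * r)) w) (\<bar>t\<bar> * c)"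
proof (induction rule: collapses.induct)
  case (delete x y c g r)
  have "collapses N I (map (\<lambda>(g, r). (g, t * r)) x @ (g, t * r) # map (\<lambda>(g, r). (g, t * r)) y)
      (\<bar>t\<bar> * c + \<bar>t * r\<bar> * N g)"
    by (rule collapses.delete) (use delete in auto)
  then show ?case by (simp add: algebra_simps abs_mult)
next
  case (merge x g r s y c)
  have "collapses N I (map (\<lambda>(g, r). (g, t * r)) x @ (g, t * r) # (g, t * s) #
      map (\<lambda>(g, r). (g, t * r)) y) (\<bar>t\<bar> * c)"
    by (rule collapses.merge) (use merge in \<open>simp add: algebra_simps\<close>)
  then show ?case by simp
qed (simp add: collapses.empty)

text \<open>
  The cost is Lipschitz in every exponent. In the induction the letter either survives the first
  move, is merged (and the shift is passed to the merged letter), or is deleted at the new price.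
\<close>
lemma collapses_shift:
  assumes N: "\<And>g. g \<in> I \<Longrightarrow> 0 \<le> N g" and "g \<in> I"
    and "collapses N I (x @ (g, s) # y) c"
  shows "collapses N I (x @ (g, s + r) # y) (c + \<bar>r\<bar> * N g)"
  using assms(3)
proof (induction "x @ (g, s) # y" c arbitrary: x s y rule: collapses.induct)
  case (delete x' y' c h q)
  consider z where "x' = x @ (g, s) # z" "y = z @ (h, q) # y'"
    | "x' = x" "(h, q) = (g, s)" "y' = y"
    | z where "x = x' @ (h, q) # z" "y' = z @ (g, s) # y"
    using delete(4) by (auto simp: append_eq_append_conv2 Cons_eq_append_conv append_eq_Cons_conv)
  then show ?case
  proof cases
    case 1
    then have "collapses N I ((x @ (g, s + r) # z) @ (h, q) # y') (c + \<bar>r\<bar> * N g + \<bar>q\<bar> * N h)"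
      using delete(2)[of x s "z @ y'"] delete(3) by (intro collapses.delete) auto
    then show ?thesis using 1 by (simp add: algebra_simps)
  next
    case 2
    have "collapses N I (x @ (g, s + r) # y) (c + \<bar>s + r\<bar> * N g)"
      using delete(1,3) 2 by (intro collapses.delete) auto
    moreover have "\<bar>s + r\<bar> * N g \<le> (\<bar>s\<bar> + \<bar>r\<bar>) * N g"
      using N \<open>g \<in> I\<close> by (intro mult_right_mono) auto
    ultimately show ?thesis
      using 2 by (auto elim!: collapses_mono simp: algebra_simps)
  next
    case 3
    then have "collapses N I (x' @ (h, q) # (z @ (g, s + r) # y)) (c + \<bar>r\<bar> * N g + \<bar>q\<bar> * N h)"
      using delete(2)[of "x' @ z" s y] delete(3) by (intro collapses.delete) auto
    then show ?thesis using 3 by (simp add: algebra_simps)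
  qed
next
  case (merge x' h p q y' c)
  consider z where "x' = x @ (g, s) # z" "y = z @ (h, p) # (h, q) # y'"
    | "x' = x" "h = g" "p = s" "y = (g, q) # y'"
    | "x = x' @ [(g, p)]" "h = g" "q = s" "y = y'"
    | z where "x = x' @ (h, p) # (h, q) # z" "y' = z @ (g, s) # y"
    using merge(3) by (auto simp: append_eq_append_conv2 Cons_eq_append_conv append_eq_Cons_conv)
  then show ?case
  proof cases
    case 1
    then have "collapses N I ((x @ (g, s + r) # z) @ (h, p) # (h, q) # y') (c + \<bar>r\<bar> * N g)"
      using merge(2)[of x s "z @ (h, p + q) # y'"] by (intro collapses.merge) auto
    then show ?thesis using 1 by simp
  next
    case 2
    then have "collapses N I (x @ (g, s + r + q) # y') (c + \<bar>r\<bar> * N g)"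
      using merge(2)[of x "s + q" y'] by (simp add: algebra_simps)
    then show ?thesis using 2 collapses.merge by fastforce
  next
    case 3
    then have "collapses N I (x' @ (g, p + (s + r)) # y) (c + \<bar>r\<bar> * N g)"
      using merge(2)[of x' "p + s" y] by (simp add: algebra_simps)
    then show ?thesis using 3 collapses.merge by fastforce
  next
    case 4
    then have "collapses N I (x' @ (h, p) # (h, q) # (z @ (g, s + r) # y)) (c + \<bar>r\<bar> * N g)"
      using merge(2)[of "x' @ (h, p + q) # z" s y] by (intro collapses.merge) auto
    then show ?thesis using 4 by simp
  qed
qed simp

text \<open>
  Merging never makes a word more expensive: the first move of a collapse of the unmerged word
  either commutes with the merge, or merges one of the two letters with a neighbour, which
  associativity of addition absorbs, or deletes one of them, which \<open>collapses_shift\<close> replaces by a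
  shift of the other.
\<close>
lemma collapses_merged:
  assumes N: "\<And>g. g \<in> I \<Longrightarrow> 0 \<le> N g"
    and "collapses N I (x @ (g, r) # (g, s) # y) c"
  shows "collapses N I (x @ (g, r + s) # y) c"
  using assms(2)
proof (induction "x @ (g, r) # (g, s) # y" c arbitrary: x r s y rule: collapses.induct)
  case (delete x' y' c h q)
  consider z where "x' = x @ (g, r) # (g, s) # z" "y = z @ (h, q) # y'"
    | "x' = x" "(h, q) = (g, r)" "y' = (g, s) # y"
    | "x' = x @ [(g, r)]" "(h, q) = (g, s)" "y' = y"
    | z where "x = x' @ (h, q) # z" "y' = z @ (g, r) # (g, s) # y"
    using delete(4) by (auto simp: append_eq_append_conv2 Cons_eq_append_conv append_eq_Cons_conv)
  then show ?case
  proof cases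
    case 1
    then have "collapses N I ((x @ (g, r + s) # z) @ (h, q) # y') (c + \<bar>q\<bar> * N h)"
      using delete(2)[of x r s "z @ y'"] delete(3) by (intro collapses.delete) auto
    then show ?thesis using 1 by simp
  next
    case 2
    then show ?thesis
      using collapses_shift[of I N g x s y c r] N delete(1,3) by (auto simp: add.commute)
  next
    case 3
    then show ?thesis
      using collapses_shift[of I N g x r y c s] N delete(1,3) by auto
  next
    case 4
    then have "collapses N I (x' @ (h, q) # (z @ (g, r + s) # y)) (c + \<bar>q\<bar> * N h)"
      using delete(2)[of "x' @ z" r s y] delete(3) by (intro collapses.delete) auto
    then show ?thesis using 4 by simp
  qed
next
  case (merge x' h p q y' c)
  consider z where "x' = x @ (g, r) # (g, s) # z" "y = z @ (h, p) # (h, q) # y'"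
    | "x' = x @ [(g, r)]" "h = g" "p = s" "y = (g, q) # y'"
    | "x' = x" "h = g" "p = r" "q = s" "y = y'"
    | "x = x' @ [(g, p)]" "h = g" "q = r" "y' = (g, s) # y"
    | z where "x = x' @ (h, p) # (h, q) # z" "y' = z @ (g, r) # (g, s) # y"
    using merge(3) by (auto simp: append_eq_append_conv2 Cons_eq_append_conv append_eq_Cons_conv)
  then show ?case
  proof cases
    case 1
    then have "collapses N I ((x @ (g, r + s) # z) @ (h, p) # (h, q) # y') c"
      using merge(2)[of x r s "z @ (h, p + q) # y'"] by (intro collapses.merge) auto
    then show ?thesis using 1 by simp
  next
    case 2
    then have "collapses N I (x @ (g, (r + s) + q) # y') c"
      using merge(2)[of x r "s + q" y'] by (simp add: algebra_simps)
    then show ?thesis using 2 collapses.merge by fastforce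
  next
    case 3
    then show ?thesis using merge(1) by simp
  next
    case 4
    then have "collapses N I (x' @ (g, p + (r + s)) # y) c"
      using merge(2)[of x' "p + r" s y] by (simp add: algebra_simps)
    then show ?thesis using 4 collapses.merge by fastforce
  next
    case 5
    then have "collapses N I (x' @ (h, p) # (h, q) # (z @ (g, r + s) # y)) c"
      using merge(2)[of "x' @ (h, p + q) # z" r s y] by (intro collapses.merge) auto
    then show ?thesis using 5 by simp
  qed
qed simp

lemma collapses_drop_zero:
  assumes "collapses N I (x @ (g, 0) # y) c"
  shows "collapses N I (x @ y) c"
  using assms
proof (induction "x @ (g, 0::real) # y" c arbitrary: x y rule: collapses.induct)
  case (delete x' y' c h q)
  consider z where "x' = x @ (g, 0) # z" "y = z @ (h, q) # y'"
    | "x' = x" "(h, q) = (g, 0)" "y' = y"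
    | z where "x = x' @ (h, q) # z" "y' = z @ (g, 0) # y"
    using delete(4) by (auto simp: append_eq_append_conv2 Cons_eq_append_conv append_eq_Cons_conv)
  then show ?case
  proof cases
    case 1
    then show ?thesis
      using delete(2)[of x "z @ y'"] delete(3) collapses.delete[of N I "x @ z" y' c h q] by auto
  next
    case 2
    then show ?thesis using delete(1) by simp
  next
    case 3
    then show ?thesis
      using delete(2)[of "x' @ z" y] delete(3) collapses.delete[of N I x' "z @ y" c h q] by auto
  qed
next
  case (merge x' h p q y' c)
  consider z where "x' = x @ (g, 0) # z" "y = z @ (h, p) # (h, q) # y'"
    | "x' = x" "h = g" "p = 0" "y = (g, q) # y'"
    | "x = x' @ [(g, p)]" "h = g" "q = 0" "y = y'"
    | z where "x = x' @ (h, p) # (h, q) # z" "y' = z @ (g, 0) # y"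
    using merge(3) by (auto simp: append_eq_append_conv2 Cons_eq_append_conv append_eq_Cons_conv)
  then show ?case
  proof cases
    case 1
    then show ?thesis
      using merge(2)[of x "z @ (h, p + q) # y'"] collapses.merge[of N I "x @ z" h p q y' c] by auto
  next
    case 4
    then show ?thesis
      using merge(2)[of "x' @ (h, p + q) # z" y] collapses.merge[of N I x' h p q "z @ y" c] by auto
  qed (use merge(1) in auto)
qed simp

lemma collapses_letter_mult:
  assumes N: "\<And>g. g \<in> I \<Longrightarrow> 0 \<le> N g"
    and w: "collapses N I (x @ (g, r) # w) c"
  shows "collapses N I (x @ letter_mult (g, r) w) c"
proof (cases w)
  case Nil
  then show ?thesis using w collapses_drop_zero[of N I x g "[]" c] by auto
next
  case (Cons b v)
  obtain h s where b: "b = (h, s)" by (cases b)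
  have "collapses N I (x @ (g, r + s) # v) c" if "h = g"
    using collapses_merged[where I = I and N = N, OF N, of x g r s v c] w Cons b that by simp
  then show ?thesis
    using w Cons b collapses_drop_zero[of N I x g w c] collapses_drop_zero[of N I x g v c]
    by (cases "r = 0"; cases "h = g"; cases "r + s = 0") simp_all
qed

text \<open>
  Passing to the normal form consists of merging letters and dropping zero letters, so the cost of a
  product in the free product is at most that of the concatenated words.
\<close>
lemma collapses_foldr_letter_mult:
  assumes N: "\<And>g. g \<in> I \<Longrightarrow> 0 \<le> N g"
  shows "collapses N I (x @ u @ v) c \<Longrightarrow> collapses N I (x @ foldr letter_mult u v) c"
proof (induction u arbitrary: x)
  case (Cons a u)
  obtain g r where a: "a = (g, r)" by (cases a)
  have "collapses N I (x @ (g, r) # foldr letter_mult u v) c"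
    using Cons.IH[of "x @ [a]"] Cons.prems a by simp
  from collapses_letter_mult[where I = I and N = N, OF N this] show ?case using a by simp
qed simp

text \<open>
  The formal inverse is needed because a conjugate is collapsed from its middle outwards, before its
  normal form is computed.
\<close>
definition inv_word :: "('a \<times> real) list \<Rightarrow> ('a \<times> real) list" where
  "inv_word w = rev (map (\<lambda>(g, r). (g, - r)) w)"

lemma collapses_conj:
  assumes "set h \<subseteq> I \<times> UNIV" "collapses N I w c"
  shows "collapses N I (h @ w @ inv_word h) c"
  using assms(1)
proof (induction h)
  case (Cons x h)
  obtain g r where x: "x = (g, r)" by (cases x)
  then have "collapses N I ([] @ (g, r) # (g, - r) # []) 0"
    using collapses_letter[of g I N 0] Cons.prems by (intro collapses.merge) auto
  then show ?case
    using collapses_insert[of N I "h @ w @ inv_word h" c "[(g, r)]" "[(g, - r)]" 0] Cons x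
    by (simp add: inv_word_def)
qed (use assms(2) in \<open>simp add: inv_word_def\<close>)

lemma collapses_inv_word:
  "collapses N I w c \<Longrightarrow> collapses N I (inv_word w) c"
proof (induction rule: collapses.induct)
  case (delete x y c g r)
  have "collapses N I (inv_word y @ (g, - r) # inv_word x) (c + \<bar>- r\<bar> * N g)"
    by (rule collapses.delete) (use delete in \<open>auto simp: inv_word_def\<close>)
  then show ?case by (simp add: inv_word_def)
next
  case (merge x g r s y c)
  have "collapses N I (inv_word y @ (g, - s) # (g, - r) # inv_word x) c"
    by (rule collapses.merge) (use merge in \<open>auto simp: inv_word_def algebra_simps\<close>)
  then show ?case by (simp add: inv_word_def)
qed (simp add: inv_word_def collapses.empty)

section \<open>Conjugation-invariant pseudonorms\<close>

lemma (in group) mult_inv_cancel: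
  assumes "x \<in> carrier G" "y \<in> carrier G"
  shows "x \<otimes> (inv x \<otimes> y) = y" "inv x \<otimes> (x \<otimes> y) = y"
  using assms by (simp_all add: m_assoc[symmetric])

text \<open>
  Used both for \<open>G\<close> itself and for \<open>F\<^sub>\<real>(G)\<close>, where the letters
  named \<open>\<one>\<close> have norm 0, so that one has a pseudonorm only.
\<close>
locale pseudonormed_group = group G for G (structure) +
  fixes N :: "'a \<Rightarrow> real"
  assumes norm_nonneg: "x \<in> carrier G \<Longrightarrow> 0 \<le> N x"
    and norm_one: "N \<one> = 0"
    and norm_inv: "x \<in> carrier G \<Longrightarrow> N (inv x) = N x"
    and norm_mult: "x \<in> carrier G \<Longrightarrow> y \<in> carrier G \<Longrightarrow> N (x \<otimes> y) \<le> N x + N y"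
    and norm_conj: "x \<in> carrier G \<Longrightarrow> h \<in> carrier G \<Longrightarrow> N (h \<otimes> x \<otimes> inv h) = N x"
begin

abbreviation d :: "'a \<Rightarrow> 'a \<Rightarrow> real" where "d \<equiv> norm_dist G N"

lemma dist_nonneg: "x \<in> carrier G \<Longrightarrow> y \<in> carrier G \<Longrightarrow> 0 \<le> d x y"
  by (simp add: norm_dist_def norm_nonneg)

lemma dist_self: "x \<in> carrier G \<Longrightarrow> d x x = 0"
  by (simp add: norm_dist_def norm_one)

lemma dist_sym: "x \<in> carrier G \<Longrightarrow> y \<in> carrier G \<Longrightarrow> d x y = d y x"
  using norm_inv[of "inv x \<otimes> y"] by (simp add: norm_dist_def inv_mult_group)

lemma dist_triangle:
  assumes "x \<in> carrier G" "y \<in> carrier G" "z \<in> carrier G"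
  shows "d x z \<le> d x y + d y z"
proof -
  have "inv x \<otimes> z = (inv x \<otimes> y) \<otimes> (inv y \<otimes> z)"
    using assms by (simp add: m_assoc mult_inv_cancel)
  then show ?thesis
    using norm_mult[of "inv x \<otimes> y" "inv y \<otimes> z"] assms by (simp add: norm_dist_def)
qed

lemma norm_le_dist:
  assumes "x \<in> carrier G" "y \<in> carrier G" shows "N y \<le> N x + d x y"
proof -
  have "y = x \<otimes> (inv x \<otimes> y)"
    using assms by (simp add: mult_inv_cancel)
  then show ?thesis using norm_mult[of x "inv x \<otimes> y"] assms by (simp add: norm_dist_def)
qed

lemma norm_diff_dist:
  assumes "x \<in> carrier G" "y \<in> carrier G" shows "\<bar>N x - N y\<bar> \<le> d x y"
  using norm_le_dist[of x y] norm_le_dist[of y x] dist_sym[of x y] assms by simp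

lemma norm_conj': "x \<in> carrier G \<Longrightarrow> h \<in> carrier G \<Longrightarrow> N (inv h \<otimes> x \<otimes> h) = N x"
  using norm_conj[of x "inv h"] by simp

text \<open>
  By conjugation invariance, since \<open>(x y)\<^sup>-\<^sup>1 x' y'\<close> is a conjugate of \<open>x\<^sup>-\<^sup>1 x'\<close> times \<open>y\<^sup>-\<^sup>1 y'\<close>.
\<close>
lemma dist_mult:
  assumes "x \<in> carrier G" "y \<in> carrier G" "x' \<in> carrier G" "y' \<in> carrier G"
  shows "d (x \<otimes> y) (x' \<otimes> y') \<le> d x x' + d y y'"
proof -
  have "inv (x \<otimes> y) \<otimes> (x' \<otimes> y') = (inv y \<otimes> (inv x \<otimes> x') \<otimes> y) \<otimes> (inv y \<otimes> y')"
    using assms by (simp add: inv_mult_group m_assoc mult_inv_cancel)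
  then have "d (x \<otimes> y) (x' \<otimes> y') \<le> N (inv y \<otimes> (inv x \<otimes> x') \<otimes> y) + N (inv y \<otimes> y')"
    using norm_mult[of "inv y \<otimes> (inv x \<otimes> x') \<otimes> y" "inv y \<otimes> y'"] assms by (simp add: norm_dist_def)
  then show ?thesis using assms norm_conj'[of "inv x \<otimes> x'" y] by (simp add: norm_dist_def)
qed

lemma dist_inv:
  assumes "x \<in> carrier G" "y \<in> carrier G"
  shows "d (inv x) (inv y) = d x y"
proof -
  have "y \<otimes> (inv y \<otimes> x) \<otimes> inv y = inv (inv x) \<otimes> inv y"
    using assms by (simp add: m_assoc[symmetric])
  then have "d (inv x) (inv y) = d y x"
    using norm_conj[of "inv y \<otimes> x" y] assms by (simp add: norm_dist_def)
  then show ?thesis using assms dist_sym by simp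
qed

lemma norm_pow:
  assumes "x \<in> carrier G" shows "N (x [^] (n::nat)) \<le> n * N x"
proof (induction n)
  case (Suc n)
  have "N (x [^] Suc n) \<le> N (x [^] n) + N x"
    using norm_mult[of "x [^] n" x] assms by simp
  then show ?case using Suc by (simp add: algebra_simps)
qed (simp add: norm_one)

lemma norm_int_pow:
  assumes "x \<in> carrier G" shows "N (x [^] (k::int)) \<le> \<bar>k\<bar> * N x"
proof (cases k)
  case (nonneg n)
  then show ?thesis using norm_pow[OF assms, of n] by (simp add: int_pow_int)
next
  case (neg n)
  have "x [^] k = inv (x [^] Suc n)"
    unfolding neg by (rule int_pow_neg_int[OF assms])
  then have "N (x [^] k) = N (x [^] Suc n)"
    using norm_inv[of "x [^] Suc n"] assms by simp
  then show ?thesis using norm_pow[OF assms, of "Suc n"] unfolding neg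
    by (simp add: add.commute)
qed

end

section \<open>The norm of the free product as a collapsing cost\<close>

lemma inv_real_free_product:
  assumes "w \<in> carrier (real_free_product I)"
  shows "inv\<^bsub>real_free_product I\<^esub> w = inv_word w" and "inv_word w \<in> carrier (real_free_product I)"
proof -
  show c: "inv_word w \<in> carrier (real_free_product I)"
    using assms unfolding inv_word_def
    by (auto simp: real_free_product_def successively_map case_prod_beta neq_commute)
  have "foldr letter_mult (inv_word w) (foldr letter_mult w []) = []"
    unfolding inv_word_def
    by (rule foldr_letter_inverse[OF carrier_letters[OF assms] carrier_Nil])
  then show "inv\<^bsub>real_free_product I\<^esub> w = inv_word w"
    using assms c by (intro group.inv_equality[OF group_real_free_product])
      (simp_all add: mult_real_free_product one_real_free_product foldr_letter_self)
qed

lemma free_letter_mult: "free_letter g r \<otimes>\<^bsub>real_free_product I\<^esub> w = letter_mult (g, r) w"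
  by (simp add: free_letter_def mult_real_free_product letter_mult_zero)

context
  fixes N :: "'a \<Rightarrow> real" and I :: "'a set"
  assumes N_nonneg: "\<And>g. g \<in> I \<Longrightarrow> 0 \<le> N g"
begin

lemma collapses_mult:
  assumes "collapses N I u c" "collapses N I v c'"
  shows "collapses N I (u \<otimes>\<^bsub>real_free_product I\<^esub> v) (c + c')"
  using collapses_foldr_letter_mult[of I N "[]" u v] collapses_append[OF assms] N_nonneg
  by (simp add: mult_real_free_product)

lemma collapses_mult_conj:
  assumes h: "h \<in> carrier (real_free_product I)" and "w \<in> carrier (real_free_product I)"
    "collapses N I w c"
  shows "collapses N I (h \<otimes>\<^bsub>real_free_product I\<^esub> w \<otimes>\<^bsub>real_free_product I\<^esub> inv\<^bsub>real_free_product I\<^esub> h) c"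
proof -
  interpret group "real_free_product I" by (rule group_real_free_product)
  have "collapses N I (h @ w @ inv_word h) c"
    using carrier_letters[OF h] assms(3) by (rule collapses_conj)
  then have "collapses N I (h @ foldr letter_mult w (inv_word h)) c"
    using collapses_foldr_letter_mult[where I = I and N = N, OF N_nonneg] by blast
  then have "collapses N I ([] @ foldr letter_mult h (foldr letter_mult w (inv_word h))) c"
    by (intro collapses_foldr_letter_mult[where I = I and N = N, OF N_nonneg]) auto
  then have "collapses N I (h \<otimes>\<^bsub>real_free_product I\<^esub> (w \<otimes>\<^bsub>real_free_product I\<^esub> inv\<^bsub>real_free_product I\<^esub> h)) c"
    using h by (simp add: inv_real_free_product mult_real_free_product)
  then show ?thesis using assms by (simp add: m_assoc)
qed

lemma collapses_free_letter:
  "g \<in> I \<Longrightarrow> collapses N I (free_letter g r) (\<bar>r\<bar> * N g)"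
  using collapses_letter[of g I N r] by (auto simp: free_letter_def intro: collapses.empty)

end

text \<open>
  The set whose infimum is \<open>free_norm G N x\<close>.
\<close>
definition conj_costs :: "('a, 'b) monoid_scheme \<Rightarrow> ('a \<Rightarrow> real) \<Rightarrow> ('a \<times> real) list \<Rightarrow> real set" where
  "conj_costs G N x = {(\<Sum>i<n. \<bar>r i\<bar> * N (g i)) | (n::nat) r g h (e :: nat \<Rightarrow> int).
     (\<forall>i<n. g i \<in> carrier G \<and> h i \<in> carrier (FR G) \<and> e i \<in> {1, -1}) \<and>
     x = foldr (\<otimes>\<^bsub>FR G\<^esub>)
           (map (\<lambda>i. h i \<otimes>\<^bsub>FR G\<^esub> (free_letter (g i) (r i) [^]\<^bsub>FR G\<^esub> e i) \<otimes>\<^bsub>FR G\<^esub> inv\<^bsub>FR G\<^esub> h i) [0..<n])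
           \<one>\<^bsub>FR G\<^esub>}"

lemma conj_costs_Nil: "0 \<in> conj_costs G N []"
  unfolding conj_costs_def by (intro CollectI exI[of _ 0]) (simp add: one_real_free_product)

text \<open>
  The new conjugate is put at index 0, and the sequences of the given decomposition are shifted by one.
\<close>
lemma conj_costs_step:
  assumes "s \<in> conj_costs G N x" "g \<in> carrier G" "h \<in> carrier (FR G)"
  shows "\<bar>r\<bar> * N g + s \<in> conj_costs G N
    ((h \<otimes>\<^bsub>FR G\<^esub> free_letter g r \<otimes>\<^bsub>FR G\<^esub> inv\<^bsub>FR G\<^esub> h) \<otimes>\<^bsub>FR G\<^esub> x)"
proof -
  interpret R: group "FR G" by (rule group_real_free_product)
  obtain n :: nat and rr gg hh and e :: "nat \<Rightarrow> int" where
    *: "s = (\<Sum>i<n. \<bar>rr i\<bar> * N (gg i))"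
      "\<forall>i<n. gg i \<in> carrier G \<and> hh i \<in> carrier (FR G) \<and> e i \<in> {1, -1}"
      "x = foldr (\<otimes>\<^bsub>FR G\<^esub>)
           (map (\<lambda>i. hh i \<otimes>\<^bsub>FR G\<^esub> (free_letter (gg i) (rr i) [^]\<^bsub>FR G\<^esub> e i) \<otimes>\<^bsub>FR G\<^esub> inv\<^bsub>FR G\<^esub> hh i) [0..<n])
           \<one>\<^bsub>FR G\<^esub>"
    using assms(1) unfolding conj_costs_def by blast
  show ?thesis
    unfolding conj_costs_def
  proof (intro CollectI exI conjI)
    show "\<bar>r\<bar> * N g + s = (\<Sum>i<Suc n. \<bar>case_nat r rr i\<bar> * N (case_nat g gg i))"
      by (subst sum.lessThan_Suc_shift) (simp add: *)
    show "\<forall>i<Suc n. case_nat g gg i \<in> carrier G \<and> case_nat h hh i \<in> carrier (FR G) \<and>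
        case_nat 1 e i \<in> {1, -1::int}"
      using * assms by (auto split: nat.split)
    show "h \<otimes>\<^bsub>FR G\<^esub> free_letter g r \<otimes>\<^bsub>FR G\<^esub> inv\<^bsub>FR G\<^esub> h \<otimes>\<^bsub>FR G\<^esub> x =
      foldr (\<otimes>\<^bsub>FR G\<^esub>)
       (map (\<lambda>i. case_nat h hh i \<otimes>\<^bsub>FR G\<^esub>
                 (free_letter (case_nat g gg i) (case_nat r rr i) [^]\<^bsub>FR G\<^esub> case_nat 1 e i) \<otimes>\<^bsub>FR G\<^esub>
                 inv\<^bsub>FR G\<^esub> case_nat h hh i)
         [0..<Suc n])
       \<one>\<^bsub>FR G\<^esub>"
      unfolding map_upt_Suc *(3)
      using R.int_pow_1[OF free_letter_closed[OF assms(2), of r]] by simp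
  qed
qed

text \<open>
  The normal form of a word that may contain zero letters and equal neighbours.
\<close>
definition reduce :: "('a \<times> real) list \<Rightarrow> ('a \<times> real) list" where
  "reduce w = foldr letter_mult w []"

lemma reduce_closed: "set w \<subseteq> I \<times> UNIV \<Longrightarrow> reduce w \<in> carrier (real_free_product I)"
  unfolding reduce_def by (intro foldr_letter_closed carrier_Nil)

lemma reduce_append:
  assumes "set u \<subseteq> I \<times> UNIV" "set v \<subseteq> I \<times> UNIV"
  shows "reduce (u @ v) = reduce u \<otimes>\<^bsub>real_free_product I\<^esub> reduce v"
  using foldr_letter_assoc[OF assms(1) carrier_Nil reduce_closed[OF assms(2)]]
  by (simp add: reduce_def mult_real_free_product)

lemma reduce_Cons: "reduce ((g, r) # w) = free_letter g r \<otimes>\<^bsub>real_free_product I\<^esub> reduce w"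
  by (simp add: reduce_def free_letter_mult)

lemma reduce_carrier: "w \<in> carrier (real_free_product I) \<Longrightarrow> reduce w = w"
  by (simp add: reduce_def foldr_letter_self)

text \<open>
  Deleting the letter \<open>g(r)\<close> between \<open>x\<close> and \<open>y\<close> amounts to splitting off the conjugate
  \<open>x g(r) x\<^sup>-\<^sup>1\<close> from the left of the product \<open>x y\<close>, so each deletion contributes one factor.
\<close>
lemma collapses_conj_costs:
  shows "collapses N (carrier G) w c \<Longrightarrow> set w \<subseteq> carrier G \<times> UNIV \<Longrightarrow>
    \<exists>s\<in>conj_costs G N (reduce w). s \<le> c"
proof (induction rule: collapses.induct)
  case (empty c)
  then show ?case using conj_costs_Nil by (auto simp: reduce_def)
next
  case (delete x y c g r)
  interpret R: group "FR G" by (rule group_real_free_product)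
  have xy: "set x \<subseteq> carrier G \<times> UNIV" "set y \<subseteq> carrier G \<times> UNIV"
    using delete.prems by auto
  note c [simp] = reduce_closed[OF xy(1)] reduce_closed[OF xy(2)]
    free_letter_closed[OF delete(2), of r]
  obtain s where s: "s \<in> conj_costs G N (reduce (x @ y))" "s \<le> c"
    using delete xy by auto
  have "reduce (x @ (g, r) # y) = (reduce x \<otimes>\<^bsub>FR G\<^esub> free_letter g r \<otimes>\<^bsub>FR G\<^esub> inv\<^bsub>FR G\<^esub> reduce x)
      \<otimes>\<^bsub>FR G\<^esub> reduce (x @ y)"
    using delete.prems xy reduce_append[of x "carrier G" y] reduce_append[of x "carrier G" "(g, r) # y"]
      reduce_Cons[of g r y "carrier G"]
    by (simp add: R.m_assoc R.mult_inv_cancel)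
  then show ?case
    using conj_costs_step[OF s(1) delete(2), of "reduce x" r] s(2)
    by (intro bexI[of _ "\<bar>r\<bar> * N g + s"]) auto
next
  case (merge x g r s y c)
  have y: "set y \<subseteq> carrier G \<times> UNIV" using merge.prems by auto
  have "reduce (x @ (g, r) # (g, s) # y) = reduce (x @ (g, r + s) # y)"
    using letter_mult_add[OF reduce_closed[OF y], of g r s] by (simp add: reduce_def)
  then show ?case using merge by auto
qed

text \<open>
  Conversely, the middle letter of each conjugate in a decomposition is deleted, after which the
  conjugators cancel.
\<close>
lemma conj_costs_collapses:
  assumes N: "\<And>g. g \<in> carrier G \<Longrightarrow> 0 \<le> N g"
    and "s \<in> conj_costs G N x"
  shows "collapses N (carrier G) x s"
proof -
  interpret R: group "FR G" by (rule group_real_free_product)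
  obtain n :: nat and r g h and e :: "nat \<Rightarrow> int" where
    *: "s = (\<Sum>i<n. \<bar>r i\<bar> * N (g i))"
      "\<And>i. i < n \<Longrightarrow> g i \<in> carrier G" "\<And>i. i < n \<Longrightarrow> h i \<in> carrier (FR G)"
      "\<And>i. i < n \<Longrightarrow> e i = 1 \<or> e i = -1"
      "x = foldr (\<otimes>\<^bsub>FR G\<^esub>)
           (map (\<lambda>i. h i \<otimes>\<^bsub>FR G\<^esub> (free_letter (g i) (r i) [^]\<^bsub>FR G\<^esub> e i) \<otimes>\<^bsub>FR G\<^esub> inv\<^bsub>FR G\<^esub> h i) [0..<n])
           \<one>\<^bsub>FR G\<^esub>"
    using assms(2) unfolding conj_costs_def by blast
  have letter: "collapses N (carrier G) (free_letter (g i) (r i) [^]\<^bsub>FR G\<^esub> e i) (\<bar>r i\<bar> * N (g i))"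
    if "i < n" for i
  proof -
    have "free_letter (g i) (r i) [^]\<^bsub>FR G\<^esub> e i = free_letter (g i) (e i * r i)"
      using *(4)[OF that] free_letter_closed[OF *(2)[OF that], of "r i"]
        free_letter_inv[OF *(2)[OF that], of "r i"]
        R.int_pow_neg_int[of "free_letter (g i) (r i)" 1] by auto
    moreover have "\<bar>e i * r i\<bar> = \<bar>r i\<bar>"
      using *(4)[OF that] by auto
    ultimately show ?thesis
      using collapses_free_letter[of "carrier G" N "g i" "e i * r i"] N *(2)[OF that] by simp
  qed
  have "collapses N (carrier G) (foldr (\<otimes>\<^bsub>FR G\<^esub>)
       (map (\<lambda>i. h i \<otimes>\<^bsub>FR G\<^esub> (free_letter (g i) (r i) [^]\<^bsub>FR G\<^esub> e i) \<otimes>\<^bsub>FR G\<^esub> inv\<^bsub>FR G\<^esub> h i) js)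
       \<one>\<^bsub>FR G\<^esub>) (\<Sum>i\<leftarrow>js. \<bar>r i\<bar> * N (g i))" if "set js \<subseteq> {..<n}" for js
    using that
  proof (induction js)
    case Nil
    then show ?case by (simp add: one_real_free_product collapses.empty)
  next
    case (Cons i js)
    then have "collapses N (carrier G)
        (h i \<otimes>\<^bsub>FR G\<^esub> (free_letter (g i) (r i) [^]\<^bsub>FR G\<^esub> e i) \<otimes>\<^bsub>FR G\<^esub> inv\<^bsub>FR G\<^esub> h i) (\<bar>r i\<bar> * N (g i))"
      using N *(2,3) by (intro collapses_mult_conj letter R.int_pow_closed free_letter_closed) auto
    then show ?case
      using Cons collapses_mult[where I = "carrier G" and N = N, OF N] by simp
  qed
  from this[of "[0..<n]"] show ?thesis
    unfolding *(1) *(5) by (simp add: interv_sum_list_conv_sum_set_nat atLeast0LessThan)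
qed

context
  fixes G :: "('a, 'b) monoid_scheme" and N :: "'a \<Rightarrow> real"
  assumes N: "\<And>g. g \<in> carrier G \<Longrightarrow> 0 \<le> N g"
begin

lemma free_norm_conj_costs: "free_norm G N x = Inf (conj_costs G N x)"
  by (simp add: free_norm_def conj_costs_def)

lemma conj_costs_nonneg: "s \<in> conj_costs G N x \<Longrightarrow> 0 \<le> s"
  using conj_costs_collapses[where G = G and N = N, OF N]
    collapses_nonneg[where I = "carrier G" and N = N, OF N] by blast

text \<open>
  Together with \<open>collapses_free_norm\<close> this identifies the norm of \<open>x\<close> with the infimum of the costs
  at which \<open>x\<close> collapses.
\<close>
lemma free_norm_le:
  assumes x: "x \<in> carrier (FR G)" and "collapses N (carrier G) x c"
  shows "free_norm G N x \<le> c"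
proof -
  obtain s where "s \<in> conj_costs G N x" "s \<le> c"
    using collapses_conj_costs[where G = G and N = N, OF assms(2) carrier_letters[OF x]]
      reduce_carrier[OF x] by auto
  moreover have "bdd_below (conj_costs G N x)"
    using conj_costs_nonneg by (intro bdd_belowI) auto
  ultimately show ?thesis
    unfolding free_norm_conj_costs using cInf_lower by fastforce
qed

lemma conj_costs_nonempty:
  assumes x: "x \<in> carrier (FR G)" shows "conj_costs G N x \<noteq> {}"
  using collapses_conj_costs[where G = G and N = N, OF collapses_cost[OF carrier_letters[OF x]]
     carrier_letters[OF x]] reduce_carrier[OF x] by auto

lemma collapses_free_norm:
  assumes x: "x \<in> carrier (FR G)" and "free_norm G N x < c"
  shows "collapses N (carrier G) x c"
proof -
  obtain s where "s \<in> conj_costs G N x" "s < c"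
    using cInf_lessD[OF conj_costs_nonempty[OF x]] assms(2) unfolding free_norm_conj_costs by blast
  then show ?thesis
    using conj_costs_collapses[where G = G and N = N, OF N] collapses_mono by fastforce
qed

lemma free_norm_letter:
  "g \<in> carrier G \<Longrightarrow> free_norm G N (free_letter g r) \<le> \<bar>r\<bar> * N g"
  by (intro free_norm_le free_letter_closed collapses_free_letter) (auto simp: N)

lemma pseudonormed_free_product: "pseudonormed_group (FR G) (free_norm G N)"
proof -
  interpret R: group "FR G" by (rule group_real_free_product)
  have conj_le: "free_norm G N (h \<otimes>\<^bsub>FR G\<^esub> x \<otimes>\<^bsub>FR G\<^esub> inv\<^bsub>FR G\<^esub> h) \<le> free_norm G N x"
    if "x \<in> carrier (FR G)" "h \<in> carrier (FR G)" for x h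
  proof (rule field_le_epsilon)
    fix e :: real assume "0 < e"
    then have "collapses N (carrier G) x (free_norm G N x + e)"
      using that by (intro collapses_free_norm) auto
    then show "free_norm G N (h \<otimes>\<^bsub>FR G\<^esub> x \<otimes>\<^bsub>FR G\<^esub> inv\<^bsub>FR G\<^esub> h) \<le> free_norm G N x + e"
      using that by (intro free_norm_le collapses_mult_conj) (auto simp: N)
  qed
  have inv_le: "free_norm G N (inv\<^bsub>FR G\<^esub> x) \<le> free_norm G N x" if "x \<in> carrier (FR G)" for x
  proof (rule field_le_epsilon)
    fix e :: real assume "0 < e"
    then have "collapses N (carrier G) x (free_norm G N x + e)"
      using that by (intro collapses_free_norm) auto
    then have "collapses N (carrier G) (inv\<^bsub>FR G\<^esub> x) (free_norm G N x + e)"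
      using collapses_inv_word inv_real_free_product(1)[OF that] by metis
    then show "free_norm G N (inv\<^bsub>FR G\<^esub> x) \<le> free_norm G N x + e"
      using that by (intro free_norm_le) auto
  qed
  show ?thesis
  proof
    fix x assume x: "x \<in> carrier (FR G)"
    show "0 \<le> free_norm G N x"
      unfolding free_norm_conj_costs
      using conj_costs_nonempty[OF x] conj_costs_nonneg by (intro cInf_greatest) auto
    show "free_norm G N (inv\<^bsub>FR G\<^esub> x) = free_norm G N x"
      using inv_le[OF x] inv_le[of "inv\<^bsub>FR G\<^esub> x"] x by simp
    fix y assume y: "y \<in> carrier (FR G)"
    show "free_norm G N (x \<otimes>\<^bsub>FR G\<^esub> y) \<le> free_norm G N x + free_norm G N y"
    proof (rule field_le_epsilon)
      fix e :: real assume "0 < e"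
      then have "collapses N (carrier G) x (free_norm G N x + e / 2)"
        "collapses N (carrier G) y (free_norm G N y + e / 2)"
        using x y by (auto intro!: collapses_free_norm)
      then have "collapses N (carrier G) (x \<otimes>\<^bsub>FR G\<^esub> y)
          ((free_norm G N x + e / 2) + (free_norm G N y + e / 2))"
        by (intro collapses_mult) (auto simp: N)
      then have "free_norm G N (x \<otimes>\<^bsub>FR G\<^esub> y) \<le> (free_norm G N x + e / 2) + (free_norm G N y + e / 2)"
        using x y by (intro free_norm_le) auto
      then show "free_norm G N (x \<otimes>\<^bsub>FR G\<^esub> y) \<le> free_norm G N x + free_norm G N y + e"
        by simp
    qed
    have "free_norm G N (inv\<^bsub>FR G\<^esub> y \<otimes>\<^bsub>FR G\<^esub> (y \<otimes>\<^bsub>FR G\<^esub> x \<otimes>\<^bsub>FR G\<^esub> inv\<^bsub>FR G\<^esub> y) \<otimes>\<^bsub>FR G\<^esub> inv\<^bsub>FR G\<^esub> (inv\<^bsub>FR G\<^esub> y))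
        \<le> free_norm G N (y \<otimes>\<^bsub>FR G\<^esub> x \<otimes>\<^bsub>FR G\<^esub> inv\<^bsub>FR G\<^esub> y)"
      using x y by (intro conj_le) auto
    also have "inv\<^bsub>FR G\<^esub> y \<otimes>\<^bsub>FR G\<^esub> (y \<otimes>\<^bsub>FR G\<^esub> x \<otimes>\<^bsub>FR G\<^esub> inv\<^bsub>FR G\<^esub> y) \<otimes>\<^bsub>FR G\<^esub> inv\<^bsub>FR G\<^esub> (inv\<^bsub>FR G\<^esub> y) = x"
      using x y by (simp add: R.m_assoc R.mult_inv_cancel)
    finally show "free_norm G N (y \<otimes>\<^bsub>FR G\<^esub> x \<otimes>\<^bsub>FR G\<^esub> inv\<^bsub>FR G\<^esub> y) = free_norm G N x"
      using conj_le[OF x y] by simp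
  next
    show "free_norm G N \<one>\<^bsub>FR G\<^esub> = 0"
      using free_norm_le[of "[]" 0] conj_costs_nonempty[of "[]"] conj_costs_nonneg
      unfolding one_real_free_product free_norm_conj_costs
      by (intro antisym cInf_greatest) (auto simp: carrier_Nil collapses.empty)
  qed
qed

end

section \<open>The projection to G does not increase norms\<close>

lemma psi_reduce: "psi G t w = reduce (map (\<lambda>(g, r). (g, t * r)) w)"
proof (induction w)
  case Nil
  then show ?case by (simp add: psi_def free_lift_def reduce_def one_real_free_product)
next
  case (Cons x w)
  then show ?case
    by (cases x) (simp add: psi_def free_lift_def reduce_def free_letter_mult)
qed

lemma psi_carrier:
  assumes "w \<in> carrier (FR G)" "t \<noteq> 0"
  shows "psi G t w = map (\<lambda>(g, r). (g, t * r)) w"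
    and "map (\<lambda>(g, r). (g, t * r)) w \<in> carrier (FR G)"
proof -
  show "map (\<lambda>(g, r). (g, t * r)) w \<in> carrier (FR G)"
    using assms by (auto simp: real_free_product_def successively_map case_prod_beta)
  then show "psi G t w = map (\<lambda>(g, r). (g, t * r)) w"
    by (simp add: psi_reduce reduce_carrier)
qed

lemma psi_closed: "w \<in> carrier (FR G) \<Longrightarrow> psi G t w \<in> carrier (FR G)"
  using psi_hom by (rule hom_in_carrier)

lemma psi_mult:
  "u \<in> carrier (FR G) \<Longrightarrow> v \<in> carrier (FR G) \<Longrightarrow>
    psi G t (u \<otimes>\<^bsub>FR G\<^esub> v) = psi G t u \<otimes>\<^bsub>FR G\<^esub> psi G t v"
  using psi_hom by (rule hom_mult)

lemma psi_inv:
  assumes "w \<in> carrier (FR G)"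
  shows "psi G t (inv\<^bsub>FR G\<^esub> w) = inv\<^bsub>FR G\<^esub> psi G t w"
proof -
  interpret group_hom "FR G" "FR G" "psi G t"
    by (simp add: group_hom_def group_hom_axioms_def group_real_free_product psi_hom)
  show ?thesis using assms by simp
qed

lemma subgroup_FZ: "subgroup (carrier (FZ G)) (FR G)"
  unfolding FZ_def
  by (simp, rule group.generate_is_subgroup[OF group_real_free_product])
     (auto intro: free_letter_closed)

lemma mult_FZ: "u \<otimes>\<^bsub>FZ G\<^esub> v = u \<otimes>\<^bsub>FR G\<^esub> v"
  by (simp add: FZ_def)

lemma FZ_subset: "w \<in> carrier (FZ G) \<Longrightarrow> w \<in> carrier (FR G)"
  using subgroup.mem_carrier[OF subgroup_FZ] .

lemma psi_FZ_closed: "w \<in> carrier (FZ G) \<Longrightarrow> psi G t w \<in> carrier (FR G)"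
  by (intro psi_closed FZ_subset)

lemma FZ_mult_closed: "u \<in> carrier (FZ G) \<Longrightarrow> v \<in> carrier (FZ G) \<Longrightarrow> u \<otimes>\<^bsub>FR G\<^esub> v \<in> carrier (FZ G)"
  by (rule subgroup.m_closed[OF subgroup_FZ])

lemma FZ_inv_closed: "u \<in> carrier (FZ G) \<Longrightarrow> inv\<^bsub>FR G\<^esub> u \<in> carrier (FZ G)"
  by (rule subgroup.m_inv_closed[OF subgroup_FZ])

lemma free_letter_int_pow:
  assumes "g \<in> carrier G"
  shows "free_letter g (of_int k) = free_letter g 1 [^]\<^bsub>FR G\<^esub> k"
proof -
  interpret R: group "FR G" by (rule group_real_free_product)
  note c [simp] = free_letter_closed[OF assms]
  have nat: "free_letter g (of_nat n) = free_letter g 1 [^]\<^bsub>FR G\<^esub> n" for n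
  proof (induction n)
    case 0
    then show ?case by (simp add: free_letter_def one_real_free_product)
  next
    case (Suc n)
    have "free_letter g (of_nat (Suc n)) = free_letter g (of_nat n) \<otimes>\<^bsub>FR G\<^esub> free_letter g 1"
      by (subst free_letter_add) (simp add: add.commute)
    then show ?case using Suc by simp
  qed
  show ?thesis
  proof (cases k)
    case (nonneg n)
    then show ?thesis using nat[of n] by (simp add: int_pow_int)
  next
    case (neg n)
    have "free_letter g 1 [^]\<^bsub>FR G\<^esub> k = inv\<^bsub>FR G\<^esub> (free_letter g 1 [^]\<^bsub>FR G\<^esub> Suc n)"
      unfolding neg by (rule R.int_pow_neg_int) simp
    also have "\<dots> = free_letter g (- of_nat (Suc n))"
      unfolding nat[symmetric] by (rule free_letter_inv[OF assms])
    finally show ?thesis unfolding neg by simp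
  qed
qed

lemma free_letter_FZ:
  assumes "g \<in> carrier G"
  shows "free_letter g (of_int k) \<in> carrier (FZ G)"
proof -
  have "free_letter g 1 \<in> carrier (FZ G)"
    using assms by (auto simp: FZ_def intro: generate.incl)
  then show ?thesis
    unfolding free_letter_int_pow[OF assms]
    using group.subgroup_int_pow_closed[OF group_real_free_product subgroup_FZ] by blast
qed

lemma free_letter_one_FZ: "g \<in> carrier G \<Longrightarrow> free_letter g 1 \<in> carrier (FZ G)"
  using free_letter_FZ[of g G 1] by simp

locale conj_normed_group = group G for G (structure) +
  fixes N :: "'a \<Rightarrow> real"
  assumes group_norm: "group_norm G N" and conj_invariant: "conj_invariant G N"

sublocale conj_normed_group \<subseteq> pseudonormed_group G N
  using group_norm conj_invariant by unfold_locales (auto simp: group_norm_def conj_invariant_def)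

sublocale conj_normed_group \<subseteq> R: pseudonormed_group "FR G" "free_norm G N"
  by (rule pseudonormed_free_product) (rule norm_nonneg)

context conj_normed_group
begin

lemma free_proj_closed: "v \<in> carrier (FZ G) \<Longrightarrow> free_proj G v \<in> carrier G"
  using free_proj_hom[OF is_group] by (rule hom_in_carrier)

lemma free_proj_mult:
  "u \<in> carrier (FZ G) \<Longrightarrow> v \<in> carrier (FZ G) \<Longrightarrow>
    free_proj G (u \<otimes>\<^bsub>FR G\<^esub> v) = free_proj G u \<otimes> free_proj G v"
  using hom_mult[OF free_proj_hom[OF is_group]] by (simp add: mult_FZ)

lemma free_proj_inv:
  assumes "u \<in> carrier (FZ G)" shows "free_proj G (inv\<^bsub>FR G\<^esub> u) = inv free_proj G u"
proof -
  have "free_proj G (inv\<^bsub>FR G\<^esub> u) \<otimes> free_proj G u = free_proj G \<one>\<^bsub>FR G\<^esub>"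
    using assms by (simp flip: free_proj_mult add: FZ_inv_closed FZ_subset)
  also have "\<dots> = \<one>"
    by (simp add: free_proj_def free_lift_def one_real_free_product)
  finally show ?thesis
    using assms by (intro inv_equality[symmetric]) (simp_all add: free_proj_closed FZ_inv_closed)
qed

lemma free_proj_int_letter:
  assumes "g \<in> carrier G" shows "free_proj G (free_letter g (of_int k)) = g [^] k"
  using assms by (simp add: free_proj_def free_lift_def free_letter_def)

lemma free_proj_word_closed:
  "set w \<subseteq> carrier G \<times> UNIV \<Longrightarrow> free_proj G w \<in> carrier G"
  by (induction w) (auto simp: free_proj_def free_lift_def)

lemma free_proj_append:
  assumes "set u \<subseteq> carrier G \<times> UNIV" "set v \<subseteq> carrier G \<times> UNIV"
  shows "free_proj G (u @ v) = free_proj G u \<otimes> free_proj G v"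
  using assms
proof (induction u)
  case Nil
  then show ?case using free_proj_word_closed[of v] by (simp add: free_proj_def free_lift_def)
next
  case (Cons x u)
  then show ?case
    using free_proj_word_closed[of u] free_proj_word_closed[of v]
    by (cases x) (simp add: free_proj_def free_lift_def m_assoc)
qed

lemma free_proj_Cons: "free_proj G ((g, r) # v) = g [^] \<lfloor>r\<rfloor> \<otimes> free_proj G v"
  by (simp add: free_proj_def free_lift_def)

text \<open>
  Deleting a letter \<open>(g, r)\<close> multiplies the image in \<open>G\<close> by a conjugate of a power of \<open>g\<close> with exponent
  \<open>r\<close>, and merging two letters with integral exponents does not change the image. Integrality is
  inherited by all words of the collapse, which is why fractional exponents do not help.
\<close>
lemma collapses_free_proj:
  assumes "collapses N (carrier G) w c" "set w \<subseteq> carrier G \<times> \<int>"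
  shows "N (free_proj G w) \<le> c"
  using assms
proof (induction rule: collapses.induct)
  case (empty c)
  then show ?case by (simp add: free_proj_def free_lift_def norm_one)
next
  case (delete x y c g r)
  have xy: "set x \<subseteq> carrier G \<times> UNIV" "set y \<subseteq> carrier G \<times> UNIV"
    using delete.prems by auto
  note [simp] = free_proj_word_closed[OF xy(1)] free_proj_word_closed[OF xy(2)] \<open>g \<in> carrier G\<close>
  define a where "a = free_proj G x \<otimes> g [^] \<lfloor>r\<rfloor> \<otimes> inv free_proj G x"
  have "free_proj G (x @ (g, r) # y) = a \<otimes> free_proj G (x @ y)"
    using xy by (simp add: a_def free_proj_append free_proj_Cons m_assoc mult_inv_cancel)
  moreover have "N a = N (g [^] \<lfloor>r\<rfloor>)"
    by (simp add: a_def norm_conj)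
  moreover have "N (g [^] \<lfloor>r\<rfloor>) \<le> \<bar>r\<bar> * N g"
    using norm_int_pow[of g "\<lfloor>r\<rfloor>"] delete.prems by (auto elim!: Ints_cases)
  moreover have "N (free_proj G (x @ y)) \<le> c"
    using delete by auto
  moreover have "N (a \<otimes> free_proj G (x @ y)) \<le> N a + N (free_proj G (x @ y))"
    using xy by (intro norm_mult) (auto simp: a_def intro!: free_proj_word_closed)
  ultimately show ?case by simp
next
  case (merge x g r s y c)
  have xy: "set x \<subseteq> carrier G \<times> UNIV" "set y \<subseteq> carrier G \<times> UNIV"
    and g [simp]: "g \<in> carrier G" and r: "r \<in> \<int>" "s \<in> \<int>"
    using merge.prems by auto
  have "g [^] \<lfloor>r + s\<rfloor> = g [^] \<lfloor>r\<rfloor> \<otimes> g [^] \<lfloor>s\<rfloor>"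
    using r by (auto elim!: Ints_cases simp: int_pow_mult simp flip: of_int_add)
  then have "free_proj G (x @ (g, r) # (g, s) # y) = free_proj G (x @ (g, r + s) # y)"
    using xy free_proj_word_closed[OF xy(2)]
    by (simp add: free_proj_append free_proj_Cons m_assoc)
  then show ?case using merge by (auto simp: r)
qed

text \<open>
  A collapse of \<open>\<psi>\<^sub>1\<^sub>/\<^sub>t(v)\<close> is a collapse of \<open>v\<close> with all exponents, and hence the cost, divided by \<open>t\<close>.
\<close>
lemma norm_free_proj_le:
  assumes v: "v \<in> carrier (FZ G)" and "0 < t"
  shows "N (free_proj G v) / t \<le> free_norm G N (psi G (1 / t) v)"
proof (rule field_le_epsilon)
  fix e :: real assume "0 < e"
  let ?c = "free_norm G N (psi G (1 / t) v) + e"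
  let ?m = "\<lambda>t. map (\<lambda>(g :: 'a, r). (g, t * r))"
  have "psi G (1 / t) v = ?m (1 / t) v"
    using psi_carrier(1)[OF FZ_subset[OF v]] \<open>0 < t\<close> by simp
  moreover have "collapses N (carrier G) (psi G (1 / t) v) ?c"
    using \<open>0 < e\<close> v by (intro collapses_free_norm psi_closed FZ_subset norm_nonneg) auto
  ultimately have "collapses N (carrier G) (?m t (?m (1 / t) v)) (\<bar>t\<bar> * ?c)"
    using collapses_scale by fastforce
  moreover have "?m t (?m (1 / t) v) = v"
    using \<open>0 < t\<close> by (simp add: case_prod_beta o_def)
  ultimately have "collapses N (carrier G) v (t * ?c)"
    using \<open>0 < t\<close> by (simp only: abs_of_pos)
  then show "N (free_proj G v) / t \<le> ?c"
    using collapses_free_proj[OF _ FZ_exponents[OF v]] \<open>0 < t\<close> by (simp add: field_simps)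
qed

end

section \<open>Limits along scaling sets\<close>

lemma eventually_at_top_in:
  "eventually P (at_top_in T) \<longleftrightarrow> (\<exists>s. \<forall>t\<in>T. s \<le> t \<longrightarrow> P t)"
  by (auto simp: at_top_in_def eventually_inf_principal eventually_at_top_linorder)

lemma eventually_at_top_in_mem: "eventually (\<lambda>t. t \<in> T) (at_top_in T)"
  by (auto simp: eventually_at_top_in)

lemma at_top_in_neq_bot:
  assumes "scaling_set T" shows "at_top_in T \<noteq> bot"
proof
  assume "at_top_in T = bot"
  then obtain s where s: "\<forall>t\<in>T. \<not> s \<le> t"
    using eventually_at_top_in[of "\<lambda>_. False" T] by auto
  then have "bdd_above T" by (intro bdd_aboveI[of _ s]) auto
  then show False using assms by (simp add: scaling_set_def)
qed

lemma scaling_set_pos: "scaling_set T \<Longrightarrow> t \<in> T \<Longrightarrow> 0 < t"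
  by (auto simp: scaling_set_def)

lemma scaling_set_unbounded:
  assumes "scaling_set T" obtains t where "t \<in> T" "s \<le> t"
  using assms unfolding scaling_set_def by (meson bdd_aboveI linorder_linear)

lemma at_top_in_mono: "T \<subseteq> T' \<Longrightarrow> at_top_in T \<le> at_top_in T'"
  unfolding le_filter_def eventually_at_top_in by blast

lemma tendsto_at_top_in_cauchy:
  fixes f :: "real \<Rightarrow> real"
  assumes T: "scaling_set T" and "cauchy_along T (\<lambda>x y. \<bar>x - y\<bar>) f"
  obtains L where "(f \<longlongrightarrow> L) (at_top_in T)"
proof -
  have "\<exists>t\<in>T. real n \<le> t" for n
    using scaling_set_unbounded[OF T] by blast
  then obtain \<sigma> where \<sigma>: "\<And>n. \<sigma> n \<in> T" "\<And>n. real n \<le> \<sigma> n" by metis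
  have lim: "filterlim \<sigma> at_top sequentially"
    by (rule filterlim_at_top_mono[OF filterlim_real_sequentially]) (simp add: \<sigma>)
  have "Cauchy (\<lambda>n. f (\<sigma> n))"
  proof (rule metric_CauchyI)
    fix e :: real assume "0 < e"
    then obtain s where s: "\<forall>t\<in>T. \<forall>t'\<in>T. s \<le> t \<and> s \<le> t' \<longrightarrow> \<bar>f t - f t'\<bar> < e"
      using assms(2) unfolding cauchy_along_def by blast
    have "\<forall>\<^sub>F n in sequentially. s \<le> \<sigma> n"
      using lim by (simp add: filterlim_at_top)
    then obtain M where "\<And>n. M \<le> n \<Longrightarrow> s \<le> \<sigma> n"
      by (auto simp: eventually_sequentially)
    then show "\<exists>M. \<forall>m\<ge>M. \<forall>n\<ge>M. dist (f (\<sigma> m)) (f (\<sigma> n)) < e"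
      using s \<sigma>(1) by (intro exI[of _ M]) (simp add: dist_real_def)
  qed
  then obtain L where L: "(\<lambda>n. f (\<sigma> n)) \<longlonglongrightarrow> L"
    using real_Cauchy_convergent convergent_def by blast
  have "(f \<longlongrightarrow> L) (at_top_in T)"
  proof (rule tendstoI)
    fix e :: real assume "0 < e"
    then obtain s where s: "\<forall>t\<in>T. \<forall>t'\<in>T. s \<le> t \<and> s \<le> t' \<longrightarrow> \<bar>f t - f t'\<bar> < e / 2"
      using assms(2) unfolding cauchy_along_def by (meson half_gt_zero)
    have "\<forall>\<^sub>F n in sequentially. s \<le> \<sigma> n \<and> dist (f (\<sigma> n)) L < e / 2"
      using lim tendstoD[OF L, of "e / 2"] \<open>0 < e\<close> by (simp add: filterlim_at_top eventually_conj)
    then obtain n where n: "s \<le> \<sigma> n" "dist (f (\<sigma> n)) L < e / 2"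
      by (auto simp: eventually_sequentially)
    show "\<forall>\<^sub>F t in at_top_in T. dist (f t) L < e"
      unfolding eventually_at_top_in
    proof (intro exI ballI impI)
      fix t assume "t \<in> T" "s \<le> t"
      then have "\<bar>f t - f (\<sigma> n)\<bar> < e / 2"
        using n \<sigma>(1)[of n] s by blast
      then show "dist (f t) L < e"
        using n unfolding dist_real_def by linarith
    qed
  qed
  then show ?thesis using that by blast
qed

section \<open>Word products modulo commutators\<close>

text \<open>
  Only the exponents of the letters vary with the function \<open>m\<close>, which acts as a rounding rule; the
  names of the letters stay fixed.
\<close>
definition word_prod :: "('a, 'b) monoid_scheme \<Rightarrow> (real \<Rightarrow> int) \<Rightarrow> ('a \<times> real) list \<Rightarrow> 'a" where
  "word_prod G m w = foldr (\<lambda>(g, r) x. g [^]\<^bsub>G\<^esub> m r \<otimes>\<^bsub>G\<^esub> x) w \<one>\<^bsub>G\<^esub>"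

lemma word_prod_simps [simp]:
  "word_prod G m [] = \<one>\<^bsub>G\<^esub>"
  "word_prod G m ((g, r) # w) = g [^]\<^bsub>G\<^esub> m r \<otimes>\<^bsub>G\<^esub> word_prod G m w"
  by (simp_all add: word_prod_def)

lemma (in group) word_prod_closed [simp]:
  "set w \<subseteq> carrier G \<times> UNIV \<Longrightarrow> word_prod G m w \<in> carrier G"
  by (induction w) auto

lemma (in comm_group) word_prod_add:
  "set w \<subseteq> carrier G \<times> UNIV \<Longrightarrow>
    word_prod G (\<lambda>r. p r * k + m r) w = word_prod G p w [^] (k::int) \<otimes> word_prod G m w"
proof (induction w)
  case (Cons x w)
  obtain g r where x: "x = (g, r)" by (cases x)
  then show ?case
    using Cons by (simp add: int_pow_mult int_pow_distrib int_pow_pow m_ac)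
qed simp

lemma (in group) word_prod_subgroup:
  assumes H: "subgroup H G"
  shows "set w \<subseteq> H \<times> UNIV \<Longrightarrow> word_prod (G\<lparr>carrier := H\<rparr>) m w = word_prod G m w"
  by (induction w) (auto simp: int_pow_consistent[OF H, symmetric])

lemma (in group_hom) hom_word_prod:
  "set w \<subseteq> carrier G \<times> UNIV \<Longrightarrow> h (word_prod G m w) = word_prod H m (map (apfst h) w)"
  by (induction w) (auto simp: hom_int_pow)

text \<open>
  In the abelianisation of \<open>H\<close> word products are additive in the exponents; the three factors below
  multiply to the identity there.
\<close>
lemma (in group) word_prod_mod_derived:
  assumes H: "subgroup H G" and w: "set w \<subseteq> H \<times> UNIV"
  shows "inv word_prod G m w \<otimes> (inv (word_prod G p w [^] (k::int)) \<otimes> word_prod G (\<lambda>r. p r * k + m r) w)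
    \<in> derived G H"
proof -
  define M where "M = G\<lparr>carrier := H\<rparr>"
  define K where "K = derived G H"
  define q where "q a = K #>\<^bsub>M\<^esub> a" for a
  have MH: "carrier M = H" by (simp add: M_def)
  interpret M: group M unfolding M_def by (rule subgroup_imp_group[OF H])
  interpret K: normal K M unfolding M_def K_def by (rule derived_subgroup_is_normal[OF H])
  interpret Q: comm_group "M Mod K"
    unfolding M_def K_def by (rule derived_quot_of_subgroup_is_comm_group[OF H])
  interpret q: group_hom M "M Mod K" q
    unfolding group_hom_def group_hom_axioms_def q_def
    using M.is_group Q.is_group K.r_coset_hom_Mod by blast
  have wM: "set w \<subseteq> carrier M \<times> UNIV" using w by (simp add: MH)
  have qw: "set (map (apfst q) w) \<subseteq> carrier (M Mod K) \<times> UNIV"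
    using wM q.hom_closed by fastforce
  let ?P = "\<lambda>m. word_prod M m w" and ?Q = "\<lambda>m. word_prod (M Mod K) m (map (apfst q) w)"
  let ?c = "inv\<^bsub>M\<^esub> ?P m \<otimes>\<^bsub>M\<^esub> (inv\<^bsub>M\<^esub> (?P p [^]\<^bsub>M\<^esub> k) \<otimes>\<^bsub>M\<^esub> ?P (\<lambda>r. p r * k + m r))"
  note [simp] = M.word_prod_closed[OF wM] Q.word_prod_closed[OF qw]
  have "q ?c = inv\<^bsub>M Mod K\<^esub> ?Q m \<otimes>\<^bsub>M Mod K\<^esub> (inv\<^bsub>M Mod K\<^esub> (?Q p [^]\<^bsub>M Mod K\<^esub> k)
      \<otimes>\<^bsub>M Mod K\<^esub> (?Q p [^]\<^bsub>M Mod K\<^esub> k \<otimes>\<^bsub>M Mod K\<^esub> ?Q m))"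
    by (simp add: q.hom_word_prod[OF wM] q.hom_int_pow Q.word_prod_add[OF qw]
        del: mult_FactGroup one_FactGroup)
  also have "\<dots> = \<one>\<^bsub>M Mod K\<^esub>"
    by (simp add: Q.mult_inv_cancel del: mult_FactGroup one_FactGroup)
  finally have "K #>\<^bsub>M\<^esub> ?c = K"
    by (simp add: q_def FactGroup_def)
  then have "?c \<in> K"
    by (rule M.coset_join1) (simp_all add: K.is_subgroup)
  moreover have "?P m = word_prod G m w" for m
    unfolding M_def by (rule word_prod_subgroup[OF H w])
  moreover have "inv\<^bsub>M\<^esub> a = inv a" "a [^]\<^bsub>M\<^esub> j = a [^] j" if "a \<in> carrier M" for a and j :: int
    using that m_inv_consistent[OF H] int_pow_consistent[OF H] by (auto simp: M_def)
  moreover have "a \<otimes>\<^bsub>M\<^esub> b = a \<otimes> b" for a b by (simp add: M_def)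
  ultimately show ?thesis
    using M.word_prod_closed[OF wM] M.int_pow_closed[OF M.word_prod_closed[OF wM], of p k]
    by (simp add: K_def)
qed

section \<open>Convergence in the free product after rescaling\<close>

text \<open>
  With \<open>m r = \<lfloor>t * r\<rfloor>\<close> this is the element of \<open>F(G)\<close> obtained by rounding \<open>\<psi>\<^sub>t(w)\<close>.
\<close>
definition int_word :: "(real \<Rightarrow> int) \<Rightarrow> ('a \<times> real) list \<Rightarrow> ('a \<times> real) list" where
  "int_word m w = reduce (map (\<lambda>(g, r). (g, of_int (m r))) w)"

lemma int_word_Nil: "int_word m [] = \<one>\<^bsub>real_free_product I\<^esub>"
  by (simp add: int_word_def reduce_def one_real_free_product)

lemma int_word_Cons:
  "int_word m ((g, r) # w) = free_letter g (of_int (m r)) \<otimes>\<^bsub>real_free_product I\<^esub> int_word m w"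
  by (simp add: int_word_def reduce_Cons)

lemma int_word_FZ: "set w \<subseteq> carrier G \<times> UNIV \<Longrightarrow> int_word m w \<in> carrier (FZ G)"
proof (induction w)
  case Nil
  then show ?case
    using subgroup.one_closed[OF subgroup_FZ] int_word_Nil by metis
next
  case (Cons x w)
  then show ?case
    by (cases x) (auto simp: int_word_Cons[of m _ _ _ "carrier G"] intro: FZ_mult_closed free_letter_FZ)
qed

lemma tendsto_floor_div:
  "((\<lambda>t. of_int \<lfloor>t * a\<rfloor> / t) \<longlongrightarrow> a) (at_top_in T)" for a :: real
proof (rule tendsto_mono)
  show "at_top_in T \<le> at_top" by (simp add: at_top_in_def)
  have "((\<lambda>t. of_int \<lfloor>t * a\<rfloor> / t - a) \<longlongrightarrow> 0) at_top"
  proof (rule tendsto_0_le)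
    show "((\<lambda>t::real. 1 / t) \<longlongrightarrow> 0) at_top"
      by (rule tendsto_divide_0[OF tendsto_const filterlim_at_top_imp_at_infinity[OF filterlim_ident]])
    show "\<forall>\<^sub>F t in at_top. norm (of_int \<lfloor>t * a\<rfloor> / t - a) \<le> norm (1 / t) * 1"
      using eventually_gt_at_top[of 0]
    proof eventually_elim
      case (elim t)
      have "of_int \<lfloor>t * a\<rfloor> / t - a = (of_int \<lfloor>t * a\<rfloor> - t * a) / t"
        using elim by (simp add: field_simps)
      moreover have "\<bar>of_int \<lfloor>t * a\<rfloor> - t * a\<bar> \<le> 1" by linarith
      ultimately show ?case using elim by (simp add: divide_right_mono)
    qed
  qed
  then show "((\<lambda>t. of_int \<lfloor>t * a\<rfloor> / t) \<longlongrightarrow> a) at_top"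
    by (rule LIM_zero_cancel)
qed

context conj_normed_group
begin

abbreviation dR :: "('a \<times> real) list \<Rightarrow> ('a \<times> real) list \<Rightarrow> real" where
  "dR \<equiv> norm_dist (FR G) (free_norm G N)"

text \<open>
  A path \<open>w\<close> in \<open>F(G)\<close> may be Cauchy after rescaling without such a limit, as \<open>F\<^sub>\<real>(G)\<close> need
  not be complete; but the paths with a limit in \<open>F\<^sub>\<real>(G)\<close> are dense by \<open>dir_group_approx_floor\<close>, and the lifts
  constructed from rounded words are of this kind.
\<close>
definition tends_in :: "real set \<Rightarrow> (real \<Rightarrow> ('a \<times> real) list) \<Rightarrow> ('a \<times> real) list \<Rightarrow> bool" where
  "tends_in T w x \<longleftrightarrow> ((\<lambda>t. dR (psi G (1 / t) (w t)) x) \<longlongrightarrow> 0) (at_top_in T)"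

lemma free_proj_int_word:
  "set w \<subseteq> carrier G \<times> UNIV \<Longrightarrow> free_proj G (int_word m w) = word_prod G m w"
proof (induction w)
  case Nil
  then show ?case by (simp add: int_word_def reduce_def free_proj_def free_lift_def)
next
  case (Cons x w)
  then show ?case
    by (cases x) (simp add: int_word_Cons[of m _ _ _ "carrier G"] free_proj_mult free_letter_FZ
        int_word_FZ free_proj_int_letter)
qed

lemma tends_in_squeeze:
  assumes "x \<in> carrier (FR G)" "\<And>t. t \<in> T \<Longrightarrow> w t \<in> carrier (FZ G)"
    and le: "\<And>t. t \<in> T \<Longrightarrow> dR (psi G (1 / t) (w t)) x \<le> f t"
    and f: "(f \<longlongrightarrow> 0) (at_top_in T)"
  shows "tends_in T w x"
  unfolding tends_in_def
proof (rule tendsto_sandwich[OF _ _ tendsto_const f])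
  show "\<forall>\<^sub>F t in at_top_in T. 0 \<le> dR (psi G (1 / t) (w t)) x"
    using eventually_at_top_in_mem
    by (rule eventually_mono) (use assms in \<open>auto intro!: R.dist_nonneg psi_FZ_closed\<close>)
  show "\<forall>\<^sub>F t in at_top_in T. dR (psi G (1 / t) (w t)) x \<le> f t"
    using eventually_at_top_in_mem by (rule eventually_mono) (rule le)
qed

lemma tends_in_mult:
  assumes u: "\<And>t. t \<in> T \<Longrightarrow> u t \<in> carrier (FZ G)" "x \<in> carrier (FR G)" "tends_in T u x"
    and v: "\<And>t. t \<in> T \<Longrightarrow> v t \<in> carrier (FZ G)" "y \<in> carrier (FR G)" "tends_in T v y"
  shows "tends_in T (\<lambda>t. u t \<otimes>\<^bsub>FR G\<^esub> v t) (x \<otimes>\<^bsub>FR G\<^esub> y)"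
proof (rule tends_in_squeeze)
  show "dR (psi G (1 / t) (u t \<otimes>\<^bsub>FR G\<^esub> v t)) (x \<otimes>\<^bsub>FR G\<^esub> y)
      \<le> dR (psi G (1 / t) (u t)) x + dR (psi G (1 / t) (v t)) y" if "t \<in> T" for t
    using that u v by (simp add: psi_mult FZ_subset psi_closed R.dist_mult)
  show "((\<lambda>t. dR (psi G (1 / t) (u t)) x + dR (psi G (1 / t) (v t)) y) \<longlongrightarrow> 0) (at_top_in T)"
    using u(3) v(3) unfolding tends_in_def by (rule tendsto_add_zero)
qed (use u v in \<open>auto intro: FZ_mult_closed\<close>)

lemma tends_in_letter:
  assumes g: "g \<in> carrier G"
    and m: "((\<lambda>t. of_int (m t) / t) \<longlongrightarrow> \<rho>) (at_top_in T)"
  shows "tends_in T (\<lambda>t. free_letter g (of_int (m t))) (free_letter g \<rho>)"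
proof (rule tends_in_squeeze)
  show "dR (psi G (1 / t) (free_letter g (of_int (m t)))) (free_letter g \<rho>)
      \<le> \<bar>\<rho> - of_int (m t) / t\<bar> * N g" for t
    using free_norm_letter[where G = G and N = N, OF norm_nonneg g, of "\<rho> - of_int (m t) / t"] g
    by (simp add: norm_dist_def psi_letter free_letter_inv free_letter_add)
  show "((\<lambda>t. \<bar>\<rho> - of_int (m t) / t\<bar> * N g) \<longlongrightarrow> 0) (at_top_in T)"
    using tendsto_mult[OF tendsto_rabs[OF tendsto_diff[OF tendsto_const m, of \<rho>]] tendsto_const, of "N g"]
    by simp
qed (use g in \<open>auto intro: free_letter_FZ free_letter_closed\<close>)

text \<open>
  A correction of size \<open>o(t)\<close> in \<open>G\<close> can be lifted by one letter per time, even though the names of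
  these letters are unrelated.
\<close>
lemma tends_in_negligible:
  assumes T: "scaling_set T" and c: "\<And>t. t \<in> T \<Longrightarrow> c t \<in> carrier G"
    and lim: "((\<lambda>t. N (c t) / t) \<longlongrightarrow> 0) (at_top_in T)"
  shows "tends_in T (\<lambda>t. free_letter (c t) 1) \<one>\<^bsub>FR G\<^esub>"
proof (rule tends_in_squeeze[OF _ _ _ lim])
  fix t assume t: "t \<in> T"
  then show "dR (psi G (1 / t) (free_letter (c t) 1)) \<one>\<^bsub>FR G\<^esub> \<le> N (c t) / t"
    using free_norm_letter[where G = G and N = N, OF norm_nonneg c[OF t], of "- 1 / t"] c
      scaling_set_pos[OF T t]
    by (simp add: norm_dist_def psi_letter free_letter_inv free_letter_closed)
qed (use c in \<open>auto intro: free_letter_one_FZ\<close>)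

lemma tends_in_int_word:
  assumes m: "\<And>r. ((\<lambda>t. of_int (m t r) / t) \<longlongrightarrow> \<rho> r) (at_top_in T)"
  shows "set w \<subseteq> carrier G \<times> UNIV \<Longrightarrow>
    tends_in T (\<lambda>t. int_word (m t) w) (reduce (map (\<lambda>(g, r). (g, \<rho> r)) w))"
proof (induction w)
  case Nil
  then show ?case
    using R.dist_self[of "[]"] psi_closed[of "[]" G]
    by (simp add: int_word_def reduce_def tends_in_def psi_reduce carrier_Nil)
next
  case (Cons x w)
  obtain g r where x: "x = (g, r)" by (cases x)
  have w: "set (map (\<lambda>(g, r). (g, \<rho> r)) w) \<subseteq> carrier G \<times> UNIV"
    using Cons.prems by auto
  have "tends_in T (\<lambda>t. free_letter g (of_int (m t r)) \<otimes>\<^bsub>FR G\<^esub> int_word (m t) w)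
    (free_letter g (\<rho> r) \<otimes>\<^bsub>FR G\<^esub> reduce (map (\<lambda>(g, r). (g, \<rho> r)) w))"
    using Cons x reduce_closed[OF w]
    by (intro tends_in_mult tends_in_letter m)
       (auto intro: free_letter_FZ free_letter_closed int_word_FZ)
  then show ?case
    by (simp add: x int_word_Cons[of _ g r w "carrier G"] reduce_Cons[of g _ _ "carrier G"])
qed

lemma dir_group_memD:
  assumes "w \<in> carrier (dir_group G N T)"
  shows "\<And>t. t \<in> T \<Longrightarrow> w t \<in> carrier (FZ G)" "w \<in> (\<Pi>\<^sub>E t\<in>T. carrier (FZ G))"
    "cauchy_along T dR (\<lambda>t. psi G (1 / t) (w t))"
  using assms by (auto simp: dir_group_def)

lemma dir_norm_tendsto:
  assumes T: "scaling_set T" and w: "w \<in> carrier (dir_group G N T)"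
  shows "((\<lambda>t. free_norm G N (psi G (1 / t) (w t))) \<longlongrightarrow> dir_norm G N T w) (at_top_in T)"
proof -
  let ?f = "\<lambda>t. free_norm G N (psi G (1 / t) (w t))"
  have "\<bar>?f t - ?f t'\<bar> \<le> dR (psi G (1 / t) (w t)) (psi G (1 / t') (w t'))" if "t \<in> T" "t' \<in> T" for t t'
    using that dir_group_memD(1)[OF w] by (intro R.norm_diff_dist psi_closed FZ_subset)
  then have "cauchy_along T (\<lambda>x y. \<bar>x - y\<bar>) ?f"
    using dir_group_memD(3)[OF w] unfolding cauchy_along_def by (meson order_le_less_trans)
  then obtain L where "(?f \<longlongrightarrow> L) (at_top_in T)"
    using tendsto_at_top_in_cauchy[OF T] by blast
  then show ?thesis
    unfolding dir_norm_def using tendsto_Lim[OF at_top_in_neq_bot[OF T]] by metis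
qed

lemma dir_norm_nonneg:
  assumes T: "scaling_set T" and w: "w \<in> carrier (dir_group G N T)"
  shows "0 \<le> dir_norm G N T w"
proof (rule tendsto_lowerbound[OF dir_norm_tendsto[OF T w] _ at_top_in_neq_bot[OF T]])
  show "\<forall>\<^sub>F t in at_top_in T. 0 \<le> free_norm G N (psi G (1 / t) (w t))"
    using eventually_at_top_in_mem
    by (rule eventually_mono) (auto intro!: R.norm_nonneg psi_FZ_closed dir_group_memD(1)[OF w])
qed

lemma tends_in_dir_group:
  assumes T: "scaling_set T" and w: "\<And>t. t \<in> T \<Longrightarrow> w t \<in> carrier (FZ G)"
    and x: "x \<in> carrier (FR G)" and lim: "tends_in T w x"
  shows "restrict w T \<in> carrier (dir_group G N T)"
    and "dir_norm G N T (restrict w T) = free_norm G N x"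
proof -
  let ?y = "\<lambda>t. psi G (1 / t) (restrict w T t)"
  have y: "?y t \<in> carrier (FR G)" if "t \<in> T" for t
    using w that by (auto intro!: psi_FZ_closed)
  have lim': "\<forall>\<^sub>F t in at_top_in T. dR (?y t) x < e" if "0 < e" for e
    using order_tendstoD(2)[OF lim[unfolded tends_in_def] that] eventually_at_top_in_mem[of T]
    by eventually_elim simp
  have "cauchy_along T dR ?y"
    unfolding cauchy_along_def
  proof (intro allI impI)
    fix e :: real assume "0 < e"
    then obtain s where s: "\<forall>t\<in>T. s \<le> t \<longrightarrow> dR (?y t) x < e / 2"
      using lim'[of "e / 2"] unfolding eventually_at_top_in by auto
    show "\<exists>s. \<forall>t\<in>T. \<forall>t'\<in>T. s \<le> t \<and> s \<le> t' \<longrightarrow> dR (?y t) (?y t') < e"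
    proof (intro exI ballI impI)
      fix t t' assume t: "t \<in> T" "t' \<in> T" "s \<le> t \<and> s \<le> t'"
      then have "dR (?y t) x < e / 2" "dR (?y t') x < e / 2" using s by blast+
      then show "dR (?y t) (?y t') < e"
        using R.dist_triangle[OF y[OF t(1)] x y[OF t(2)]] R.dist_sym[OF y[OF t(2)] x] by simp
    qed
  qed
  then show "restrict w T \<in> carrier (dir_group G N T)"
    using w by (simp add: dir_group_def)
  have "((\<lambda>t. free_norm G N (?y t)) \<longlongrightarrow> free_norm G N x) (at_top_in T)"
  proof (rule tendstoI)
    fix e :: real assume "0 < e"
    from lim'[OF this] eventually_at_top_in_mem[of T]
    show "\<forall>\<^sub>F t in at_top_in T. dist (free_norm G N (?y t)) (free_norm G N x) < e"
    proof eventually_elim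
      case (elim t)
      then show ?case using R.norm_diff_dist[OF y[OF elim(2)] x] by (simp add: dist_real_def)
    qed
  qed
  then show "dir_norm G N T (restrict w T) = free_norm G N x"
    unfolding dir_norm_def by (rule tendsto_Lim[OF at_top_in_neq_bot[OF T]])
qed

end

section \<open>Lifts of rounded words\<close>

locale lbc_normed_group = conj_normed_group +
  assumes lbc: "locally_bounded_commutators G N"
begin

lemma derived_generate_bound:
  assumes "finite S" "S \<subseteq> carrier G"
  obtains B where "\<And>u. u \<in> derived G (generate G S) \<Longrightarrow> N u \<le> B"
proof -
  let ?D = "derived G (generate G S)"
  have D: "subgroup ?D G"
    using assms by (intro derived_is_subgroup generate_incl)
  obtain B where B: "\<forall>x\<in>?D. \<forall>y\<in>?D. norm_dist G N x y \<le> B"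
    using lbc assms unfolding locally_bounded_commutators_def norm_bounded_def by blast
  have "N u \<le> B" if "u \<in> ?D" for u
    using B[rule_format, OF subgroup.one_closed[OF D] that] subgroup.mem_carrier[OF D that]
    by (simp add: norm_dist_def)
  then show ?thesis using that by blast
qed

text \<open>
  The path \<open>p t = word_prod G (\<lambda>r. \<lfloor>t * r\<rfloor>) w\<close> has the obvious lift \<open>int_word (\<lambda>r. \<lfloor>t * r\<rfloor>) w\<close>, whose
  norm can be much larger than the growth rate of \<open>N (p t)\<close>. The lift constructed here instead
  advances by multiples of the single letter named \<open>p s\<close> and corrects the rest.
\<close>
lemma lift_int_words:
  assumes T: "scaling_set T" and w: "set w \<subseteq> carrier G \<times> UNIV" and s: "0 < s"
  obtains u where "u \<in> carrier (dir_group G N T)"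
    "\<And>t. t \<in> T \<Longrightarrow> free_proj G (u t) = word_prod G (\<lambda>r. \<lfloor>t * r\<rfloor>) w"
    "dir_norm G N T u \<le> N (word_prod G (\<lambda>r. \<lfloor>s * r\<rfloor>) w) / s + (\<Sum>(g, r)\<leftarrow>w. N g) / s"
proof -
  let ?H = "generate G (fst ` set w)"
  let ?p = "\<lambda>r. \<lfloor>s * r\<rfloor>" and ?k = "\<lambda>t. \<lfloor>t * (1 / s)\<rfloor>"
  let ?m = "\<lambda>t r. \<lfloor>t * r\<rfloor> - ?p r * ?k t"
  define y where "y = word_prod G ?p w"
  define e where "e t = word_prod G (\<lambda>r. \<lfloor>t * r\<rfloor>) w" for t
  \<comment> \<open>The error against the product of the power of \<open>y\<close> and the correction word; it lies in \<open>[H, H]\<close>.\<close>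
  define c where "c t = inv word_prod G (?m t) w \<otimes> (inv (y [^] ?k t) \<otimes> e t)" for t
  have S: "fst ` set w \<subseteq> carrier G" using w by auto
  have H: "subgroup ?H G" by (rule generate_is_subgroup[OF S])
  have wH: "set w \<subseteq> ?H \<times> UNIV" by (auto intro!: generate.incl) force
  obtain B where B: "\<And>u. u \<in> derived G ?H \<Longrightarrow> N u \<le> B"
    using derived_generate_bound[OF _ S] by auto
  have y [simp]: "y \<in> carrier G" and [simp]: "e t \<in> carrier G" for t
    unfolding y_def e_def using w by auto
  have c [simp]: "c t \<in> carrier G" for t
    unfolding c_def using w by auto
  have "c t \<in> derived G ?H" for t
    using word_prod_mod_derived[OF H wH, of "?m t" ?p "?k t"] by (simp add: c_def y_def e_def)
  then have cB: "N (c t) \<le> B" for t by (rule B)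
  have c0: "((\<lambda>t. N (c t) / t) \<longlongrightarrow> 0) (at_top_in T)"
  proof (rule tendsto_sandwich[OF _ _ tendsto_const])
    show "((\<lambda>t. B / t) \<longlongrightarrow> 0) (at_top_in T)"
      by (rule tendsto_mono[of _ at_top]) (auto simp: at_top_in_def intro!: tendsto_divide_0[OF tendsto_const]
        filterlim_at_top_imp_at_infinity[OF filterlim_ident])
    have "0 \<le> N (c t) / t" "N (c t) / t \<le> B / t" if "t \<in> T" for t
      using scaling_set_pos[OF T that] cB norm_nonneg[OF c] by (simp_all add: divide_right_mono)
    then show "\<forall>\<^sub>F t in at_top_in T. 0 \<le> N (c t) / t" "\<forall>\<^sub>F t in at_top_in T. N (c t) / t \<le> B / t"
      using eventually_at_top_in_mem[of T] by (auto elim: eventually_mono)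
  qed
  \<comment> \<open>The limit of \<open>?m t r / t\<close>; it is at most \<open>1 / s\<close> in absolute value since \<open>\<lfloor>s * r\<rfloor>\<close> is within 1 of \<open>s * r\<close>.\<close>
  define \<rho> where "\<rho> r = r - of_int (?p r) * (1 / s)" for r
  define u where "u t = free_letter y (of_int (?k t)) \<otimes>\<^bsub>FR G\<^esub>
    (int_word (?m t) w \<otimes>\<^bsub>FR G\<^esub> free_letter (c t) 1)" for t
  let ?W = "map (\<lambda>(g, r). (g, \<rho> r)) w"
  let ?x = "free_letter y (1 / s) \<otimes>\<^bsub>FR G\<^esub> (reduce ?W \<otimes>\<^bsub>FR G\<^esub> \<one>\<^bsub>FR G\<^esub>)"
  have W: "set ?W \<subseteq> carrier G \<times> UNIV" using w by auto
  have m: "((\<lambda>t. of_int (?m t r) / t) \<longlongrightarrow> \<rho> r) (at_top_in T)" for r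
    using tendsto_diff[OF tendsto_floor_div[of r] tendsto_mult[OF tendsto_const[of "of_int (?p r)"] tendsto_floor_div[of "1 / s"]]]
    by (simp add: \<rho>_def diff_divide_distrib)
  have FZ: "free_letter y (of_int (?k t)) \<in> carrier (FZ G)" "int_word (?m t) w \<in> carrier (FZ G)"
    "free_letter (c t) 1 \<in> carrier (FZ G)" for t
    using w by (auto intro: free_letter_FZ int_word_FZ free_letter_one_FZ)
  have x: "?x \<in> carrier (FR G)"
    using reduce_closed[OF W] free_letter_closed[OF y] by auto
  have u: "u t \<in> carrier (FZ G)" for t
    unfolding u_def using FZ by (intro FZ_mult_closed)
  have "tends_in T u ?x"
    unfolding u_def
    using FZ reduce_closed[OF W] free_letter_closed[OF y]
    by (intro tends_in_mult tends_in_letter tends_in_int_word tends_in_negligible[OF T]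
        m w c0 tendsto_floor_div) (auto intro: FZ_mult_closed)
  note lim = tends_in_dir_group[OF T u x this]
  have "free_proj G (restrict u T t) = e t" if "t \<in> T" for t
  proof -
    have "free_proj G (u t) = y [^] ?k t \<otimes> (word_prod G (?m t) w \<otimes> c t)"
      using FZ w by (simp add: u_def free_proj_mult FZ_mult_closed free_proj_int_letter
          free_proj_int_word free_proj_letter[OF is_group])
    also have "\<dots> = e t"
      using w by (simp add: c_def mult_inv_cancel)
    finally show ?thesis using that by simp
  qed
  moreover have "free_norm G N ?x \<le> N y / s + (\<Sum>(g, r)\<leftarrow>w. N g) / s"
  proof -
    have "(\<Sum>(g, r)\<leftarrow>?W. \<bar>r\<bar> * N g) \<le> (\<Sum>(g, r)\<leftarrow>w. N g / s)"
      unfolding map_map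
    proof (rule sum_list_mono)
      fix a assume "a \<in> set w"
      then obtain g r where a: "a = (g, r)" "g \<in> carrier G" using w by (cases a) auto
      have "\<rho> r = (s * r - of_int (?p r)) / s"
        using s by (simp add: \<rho>_def field_simps)
      moreover have "\<bar>s * r - of_int (?p r)\<bar> \<le> 1" by linarith
      ultimately have "\<bar>\<rho> r\<bar> \<le> 1 / s" using s by (simp add: divide_right_mono)
      then show "((\<lambda>(g, r). \<bar>r\<bar> * N g) \<circ> (\<lambda>(g, r). (g, \<rho> r))) a \<le> (case a of (g, r) \<Rightarrow> N g / s)"
        using mult_right_mono[of "\<bar>\<rho> r\<bar>" "1 / s" "N g"] norm_nonneg[OF a(2)] by (simp add: a)
    qed
    also have "\<dots> = (\<Sum>(g, r)\<leftarrow>w. N g) / s"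
      by (induction w) (auto simp: add_divide_distrib)
    finally have W_le: "(\<Sum>(g, r)\<leftarrow>?W. \<bar>r\<bar> * N g) \<le> (\<Sum>(g, r)\<leftarrow>w. N g) / s" .
    have "collapses N (carrier G) (reduce ?W) (\<Sum>(g, r)\<leftarrow>?W. \<bar>r\<bar> * N g)"
      unfolding reduce_def
      using collapses_foldr_letter_mult[where I = "carrier G" and N = N and x = "[]" and u = ?W and v = "[]",
          OF norm_nonneg] collapses_cost[OF W] by simp
    then have "free_norm G N (reduce ?W) \<le> (\<Sum>(g, r)\<leftarrow>?W. \<bar>r\<bar> * N g)"
      by (intro free_norm_le reduce_closed W norm_nonneg)
    moreover have "free_norm G N ?x \<le> free_norm G N (free_letter y (1 / s)) + free_norm G N (reduce ?W)"
      using R.norm_mult[OF free_letter_closed[OF y] reduce_closed[OF W]] reduce_closed[OF W] by simp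
    moreover have "free_norm G N (free_letter y (1 / s)) \<le> N y / s"
      using free_norm_letter[where G = G and N = N, OF norm_nonneg y, of "1 / s"] s by simp
    ultimately show ?thesis using W_le by linarith
  qed
  ultimately show ?thesis
    using that[OF lim(1)] lim(2) by (simp add: y_def e_def)
qed

end

section \<open>The groups of paths\<close>

text \<open>
  Solutions that exist for each accuracy at all late times can be combined into one function: at
  each time it takes a solution whose accuracy is optimal up to \<open>1 / t\<close>.
\<close>
lemma eventual_selection:
  assumes T: "scaling_set T"
    and mono: "\<And>v t \<epsilon> \<epsilon>'. P v t \<epsilon> \<Longrightarrow> \<epsilon> \<le> \<epsilon>' \<Longrightarrow> P v t \<epsilon>'"
    and ex: "\<And>\<epsilon>. 0 < \<epsilon> \<Longrightarrow> \<forall>\<^sub>F t in at_top_in T. \<exists>v. P v t \<epsilon>"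
  obtains v where "\<And>\<epsilon>::real. 0 < \<epsilon> \<Longrightarrow> \<forall>\<^sub>F t in at_top_in T. P (v t) t \<epsilon>"
proof -
  define A where "A t = {\<epsilon>. 0 < \<epsilon> \<and> (\<exists>v. P v t \<epsilon>)}" for t
  define v where "v t = (SOME v. \<exists>\<epsilon> < Inf (A t) + 1 / t. P v t \<epsilon>)" for t
  have bdd: "bdd_below (A t)" for t by (rule bdd_belowI[of _ 0]) (simp add: A_def)
  have "\<forall>\<^sub>F t in at_top_in T. P (v t) t \<epsilon>" if \<epsilon>: "0 < \<epsilon>" for \<epsilon> :: real
  proof -
    have "\<forall>\<^sub>F t in at_top_in T. 2 / \<epsilon> \<le> t"
      unfolding eventually_at_top_in by auto
    moreover have "\<forall>\<^sub>F t in at_top_in T. \<exists>v. P v t (\<epsilon> / 2)"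
      using \<epsilon> by (intro ex) simp
    ultimately show ?thesis
      using eventually_at_top_in_mem
    proof eventually_elim
      case (elim t)
      have t: "0 < t" using scaling_set_pos[OF T elim(3)] .
      have mem: "\<epsilon> / 2 \<in> A t" using elim \<epsilon> by (simp add: A_def)
      then have "Inf (A t) < Inf (A t) + 1 / t" "Inf (A t) \<le> \<epsilon> / 2"
        using t cInf_lower[OF mem bdd] by auto
      then obtain \<delta> where "\<delta> \<in> A t" "\<delta> < Inf (A t) + 1 / t"
        using cInf_lessD[of "A t"] mem by blast
      then have "\<exists>v. \<exists>\<delta> < Inf (A t) + 1 / t. P v t \<delta>" by (auto simp: A_def)
      then have "\<exists>\<delta> < Inf (A t) + 1 / t. P (v t) t \<delta>"
        unfolding v_def by (rule someI_ex)
      then obtain \<delta>' where d: "\<delta>' < Inf (A t) + 1 / t" "P (v t) t \<delta>'"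
        by blast
      moreover have "1 / t \<le> \<epsilon> / 2" using elim(1) t \<epsilon> by (simp add: field_simps)
      ultimately show ?case using \<open>Inf (A t) \<le> \<epsilon> / 2\<close> by (intro mono[OF d(2)]) linarith
    qed
  qed
  then show ?thesis using that by blast
qed

context conj_normed_group
begin

lemma dir_group_mult:
  assumes u: "u \<in> carrier (dir_group G N T)" and v: "v \<in> carrier (dir_group G N T)"
  shows "(\<lambda>t\<in>T. u t \<otimes>\<^bsub>FR G\<^esub> v t) \<in> carrier (dir_group G N T)"
proof -
  note FZ = dir_group_memD(1)[OF u] dir_group_memD(1)[OF v]
  have "cauchy_along T dR (\<lambda>t. psi G (1 / t) ((\<lambda>t\<in>T. u t \<otimes>\<^bsub>FR G\<^esub> v t) t))"
    unfolding cauchy_along_def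
  proof (intro allI impI)
    fix e :: real assume "0 < e"
    then have e: "0 < e / 2" by simp
    obtain s where s: "\<forall>t\<in>T. \<forall>t'\<in>T. s \<le> t \<and> s \<le> t' \<longrightarrow>
        dR (psi G (1 / t) (u t)) (psi G (1 / t') (u t')) < e / 2"
      using dir_group_memD(3)[OF u, unfolded cauchy_along_def, rule_format, OF e] by blast
    obtain s' where s': "\<forall>t\<in>T. \<forall>t'\<in>T. s' \<le> t \<and> s' \<le> t' \<longrightarrow>
        dR (psi G (1 / t) (v t)) (psi G (1 / t') (v t')) < e / 2"
      using dir_group_memD(3)[OF v, unfolded cauchy_along_def, rule_format, OF e] by blast
    show "\<exists>s. \<forall>t\<in>T. \<forall>t'\<in>T. s \<le> t \<and> s \<le> t' \<longrightarrow>
        dR (psi G (1 / t) ((\<lambda>t\<in>T. u t \<otimes>\<^bsub>FR G\<^esub> v t) t)) (psi G (1 / t') ((\<lambda>t\<in>T. u t \<otimes>\<^bsub>FR G\<^esub> v t) t')) < e"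
    proof (intro exI[of _ "max s s'"] ballI impI)
      fix t t' assume t: "t \<in> T" "t' \<in> T" "max s s' \<le> t \<and> max s s' \<le> t'"
      then have "dR (psi G (1 / t) (u t)) (psi G (1 / t') (u t')) < e / 2"
        "dR (psi G (1 / t) (v t)) (psi G (1 / t') (v t')) < e / 2" using s s' by simp_all
      then show "dR (psi G (1 / t) ((\<lambda>t\<in>T. u t \<otimes>\<^bsub>FR G\<^esub> v t) t))
          (psi G (1 / t') ((\<lambda>t\<in>T. u t \<otimes>\<^bsub>FR G\<^esub> v t) t')) < e"
        using R.dist_mult[of "psi G (1 / t) (u t)" "psi G (1 / t) (v t)" "psi G (1 / t') (u t')"
            "psi G (1 / t') (v t')"] t FZ
        by (simp add: psi_mult FZ_subset psi_closed)
    qed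
  qed
  then show ?thesis using FZ by (simp add: dir_group_def FZ_mult_closed)
qed

lemma dir_group_inv:
  assumes u: "u \<in> carrier (dir_group G N T)"
  shows "(\<lambda>t\<in>T. inv\<^bsub>FR G\<^esub> u t) \<in> carrier (dir_group G N T)"
proof -
  note FZ = dir_group_memD(1)[OF u]
  have "dR (psi G (1 / t) (inv\<^bsub>FR G\<^esub> u t)) (psi G (1 / t') (inv\<^bsub>FR G\<^esub> u t')) =
      dR (psi G (1 / t) (u t)) (psi G (1 / t') (u t'))" if "t \<in> T" "t' \<in> T" for t t'
    using that FZ by (simp add: psi_inv FZ_subset psi_closed R.dist_inv)
  then have "cauchy_along T dR (\<lambda>t. psi G (1 / t) ((\<lambda>t\<in>T. inv\<^bsub>FR G\<^esub> u t) t))"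
    using dir_group_memD(3)[OF u] by (simp add: cauchy_along_def)
  then show ?thesis using FZ by (simp add: dir_group_def FZ_inv_closed)
qed

lemma dir_group_one:
  assumes T: "scaling_set T" shows "(\<lambda>t\<in>T. \<one>\<^bsub>FR G\<^esub>) \<in> carrier (dir_group G N T)"
proof -
  have "tends_in T (\<lambda>t. int_word (\<lambda>r. 0) []) (reduce (map (\<lambda>(g :: 'a, r). (g, 0)) []))"
    using tends_in_int_word[where m = "\<lambda>_ _. 0" and \<rho> = "\<lambda>_. 0" and w = "[]" and T = T] by simp
  then have "tends_in T (\<lambda>t. \<one>\<^bsub>FR G\<^esub>) \<one>\<^bsub>FR G\<^esub>"
    by (simp add: int_word_def reduce_def one_real_free_product)
  then show ?thesis
    using subgroup.one_closed[OF subgroup_FZ] by (intro tends_in_dir_group(1)[OF T]) auto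
qed

lemma fun_group_memE:
  assumes "g \<in> carrier (fun_group G N T)"
  obtains w where "w \<in> carrier (dir_group G N T)" "g = (\<lambda>t\<in>T. free_proj G (w t))"
  using assms by (auto simp: fun_group_def)

lemma fun_group_memI:
  "w \<in> carrier (dir_group G N T) \<Longrightarrow> (\<lambda>t\<in>T. free_proj G (w t)) \<in> carrier (fun_group G N T)"
  by (auto simp: fun_group_def)

lemma fun_group_subgroup:
  assumes T: "scaling_set T"
  shows "subgroup (carrier (fun_group G N T)) (product_group T (\<lambda>_. G))"
proof
  show "carrier (fun_group G N T) \<subseteq> carrier (product_group T (\<lambda>_. G))"
    using dir_group_memD(1) by (auto simp: fun_group_def intro!: free_proj_closed)
  show "\<one>\<^bsub>product_group T (\<lambda>_. G)\<^esub> \<in> carrier (fun_group G N T)"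
  proof -
    have "free_proj G \<one>\<^bsub>FR G\<^esub> = \<one>"
      by (simp add: free_proj_def free_lift_def one_real_free_product)
    then have "\<one>\<^bsub>product_group T (\<lambda>_. G)\<^esub> = (\<lambda>t\<in>T. free_proj G ((\<lambda>t\<in>T. \<one>\<^bsub>FR G\<^esub>) t))"
      by (auto simp: fun_eq_iff)
    then show ?thesis using fun_group_memI[OF dir_group_one[OF T]] by simp
  qed
next
  fix g assume "g \<in> carrier (fun_group G N T)"
  then obtain u where u: "u \<in> carrier (dir_group G N T)" "g = (\<lambda>t\<in>T. free_proj G (u t))"
    by (rule fun_group_memE)
  note FZ = dir_group_memD(1)[OF u(1)]
  have "inv\<^bsub>product_group T (\<lambda>_. G)\<^esub> g = (\<lambda>t\<in>T. inv g t)"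
    using u FZ by (intro inv_product_group) (auto intro: free_proj_closed)
  also have "\<dots> = (\<lambda>t\<in>T. free_proj G ((\<lambda>t\<in>T. inv\<^bsub>FR G\<^esub> u t) t))"
    using u FZ by (auto simp: fun_eq_iff free_proj_inv)
  finally show "inv\<^bsub>product_group T (\<lambda>_. G)\<^esub> g \<in> carrier (fun_group G N T)"
    using fun_group_memI[OF dir_group_inv[OF u(1)]] by simp
  fix h assume "h \<in> carrier (fun_group G N T)"
  then obtain v where v: "v \<in> carrier (dir_group G N T)" "h = (\<lambda>t\<in>T. free_proj G (v t))"
    by (rule fun_group_memE)
  have "g \<otimes>\<^bsub>product_group T (\<lambda>_. G)\<^esub> h = (\<lambda>t\<in>T. free_proj G ((\<lambda>t\<in>T. u t \<otimes>\<^bsub>FR G\<^esub> v t) t))"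
    using u v FZ dir_group_memD(1)[OF v(1)] by (auto simp: fun_eq_iff free_proj_mult)
  then show "g \<otimes>\<^bsub>product_group T (\<lambda>_. G)\<^esub> h \<in> carrier (fun_group G N T)"
    using fun_group_memI[OF dir_group_mult[OF u(1) v(1)]] by simp
qed

lemma fun_group_eq: "fun_group G N T = (product_group T (\<lambda>_. G))\<lparr>carrier := carrier (fun_group G N T)\<rparr>"
  by (simp add: fun_group_def)

lemma group_fun_group:
  assumes T: "scaling_set T" shows "group (fun_group G N T)"
  by (subst fun_group_eq)
     (rule group.subgroup_imp_group[OF _ fun_group_subgroup[OF T]], simp add: is_group)

lemma mult_fun_group: "g \<otimes>\<^bsub>fun_group G N T\<^esub> h = (\<lambda>t\<in>T. g t \<otimes> h t)"
  and one_fun_group: "\<one>\<^bsub>fun_group G N T\<^esub> = (\<lambda>t\<in>T. \<one>)"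
  by (simp_all add: fun_group_def)

lemma fun_group_carrier:
  assumes T: "scaling_set T" and g: "g \<in> carrier (fun_group G N T)"
  shows "g \<in> (\<Pi>\<^sub>E t\<in>T. carrier G)"
  using subgroup.subset[OF fun_group_subgroup[OF T]] g by auto

lemma fun_group_closed:
  "scaling_set T \<Longrightarrow> g \<in> carrier (fun_group G N T) \<Longrightarrow> t \<in> T \<Longrightarrow> g t \<in> carrier G"
  using fun_group_carrier by (metis PiE_mem)

lemma inv_fun_group:
  assumes T: "scaling_set T" and g: "g \<in> carrier (fun_group G N T)"
  shows "inv\<^bsub>fun_group G N T\<^esub> g = (\<lambda>t\<in>T. inv g t)"
proof -
  have "group (product_group T (\<lambda>_. G))" by (simp add: is_group)
  from group.m_inv_consistent[OF this fun_group_subgroup[OF T] g]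
  have "inv\<^bsub>fun_group G N T\<^esub> g = inv\<^bsub>product_group T (\<lambda>_. G)\<^esub> g"
    using fun_group_eq[of T] by metis
  also have "\<dots> = (\<lambda>t\<in>T. inv g t)"
    using fun_group_carrier[OF T g] by (intro inv_product_group) (auto simp: is_group)
  finally show ?thesis .
qed

lemma dist_free_proj_le:
  assumes "u \<in> carrier (FZ G)" "v \<in> carrier (FZ G)" "0 < t"
  shows "d (free_proj G u) (free_proj G v) / t \<le> dR (psi G (1 / t) u) (psi G (1 / t) v)"
proof -
  have "psi G (1 / t) (inv\<^bsub>FR G\<^esub> u \<otimes>\<^bsub>FR G\<^esub> v) = inv\<^bsub>FR G\<^esub> psi G (1 / t) u \<otimes>\<^bsub>FR G\<^esub> psi G (1 / t) v"
    using assms by (simp add: psi_mult psi_inv FZ_subset)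
  moreover have "free_proj G (inv\<^bsub>FR G\<^esub> u \<otimes>\<^bsub>FR G\<^esub> v) = inv free_proj G u \<otimes> free_proj G v"
    using assms by (simp add: free_proj_mult free_proj_inv FZ_inv_closed)
  ultimately show ?thesis
    using norm_free_proj_le[OF FZ_mult_closed[OF FZ_inv_closed[OF assms(1)] assms(2)] assms(3)]
    unfolding norm_dist_def by simp
qed

text \<open>
  The approximating element is a late value of the rescaled path itself.
\<close>
lemma dir_group_approx:
  assumes T: "scaling_set T" and w: "w \<in> carrier (dir_group G N T)" and e: "0 < e"
  obtains x where "x \<in> carrier (FR G)"
    "\<forall>\<^sub>F t in at_top_in T. dR (psi G (1 / t) (w t)) x < e"
proof -
  obtain s where s: "\<forall>t\<in>T. \<forall>t'\<in>T. s \<le> t \<and> s \<le> t' \<longrightarrow>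
      dR (psi G (1 / t) (w t)) (psi G (1 / t') (w t')) < e"
    using dir_group_memD(3)[OF w] e unfolding cauchy_along_def by blast
  obtain t' where t': "t' \<in> T" "s \<le> t'"
    using scaling_set_unbounded[OF T] .
  show ?thesis
  proof (rule that)
    show "psi G (1 / t') (w t') \<in> carrier (FR G)"
      using dir_group_memD(1)[OF w t'(1)] by (rule psi_FZ_closed)
    show "\<forall>\<^sub>F t in at_top_in T. dR (psi G (1 / t) (w t)) (psi G (1 / t') (w t')) < e"
      unfolding eventually_at_top_in using s t' by blast
  qed
qed

lemma tends_in_floor_word:
  assumes x: "x \<in> carrier (FR G)"
  shows "tends_in T (\<lambda>t. int_word (\<lambda>r. \<lfloor>t * r\<rfloor>) x) x"
  using tends_in_int_word[where m = "\<lambda>t r. \<lfloor>t * r\<rfloor>" and \<rho> = "\<lambda>r. r",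
      OF tendsto_floor_div carrier_letters[OF x]] reduce_carrier[OF x]
  by simp

text \<open>
  Hence every element of \<open>\<D>(G,T)\<close> is close to a path of rounded words, both in \<open>F\<^sub>\<real>(G)\<close> and, after
  projection, in \<open>G\<close>. In \<open>G\<close> all values of this path lie in one finitely generated subgroup.
\<close>
lemma dir_group_approx_floor:
  assumes T: "scaling_set T" and w: "w \<in> carrier (dir_group G N T)" and e: "0 < e"
  obtains x where "x \<in> carrier (FR G)"
    "\<forall>\<^sub>F t in at_top_in T. dR (psi G (1 / t) (int_word (\<lambda>r. \<lfloor>t * r\<rfloor>) x)) (psi G (1 / t) (w t)) < e"
    "\<forall>\<^sub>F t in at_top_in T. d (word_prod G (\<lambda>r. \<lfloor>t * r\<rfloor>) x) (free_proj G (w t)) / t < e"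
proof -
  obtain x where x: "x \<in> carrier (FR G)"
    and wx: "\<forall>\<^sub>F t in at_top_in T. dR (psi G (1 / t) (w t)) x < e / 2"
    using dir_group_approx[OF T w, of "e / 2"] e by auto
  let ?v = "\<lambda>t. int_word (\<lambda>r. \<lfloor>t * r\<rfloor>) x"
  have v: "?v t \<in> carrier (FZ G)" for t
    using carrier_letters[OF x] by (rule int_word_FZ)
  have "\<forall>\<^sub>F t in at_top_in T. dR (psi G (1 / t) (?v t)) x < e / 2"
    using order_tendstoD(2)[OF tends_in_floor_word[OF x, unfolded tends_in_def], of "e / 2"] e
    by simp
  with wx eventually_at_top_in_mem[of T]
  have close: "\<forall>\<^sub>F t in at_top_in T. dR (psi G (1 / t) (?v t)) (psi G (1 / t) (w t)) < e"
  proof eventually_elim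
    case (elim t)
    have c: "psi G (1 / t) (w t) \<in> carrier (FR G)" "psi G (1 / t) (?v t) \<in> carrier (FR G)"
      using dir_group_memD(1)[OF w elim(2)] v by (auto intro: psi_FZ_closed)
    show ?case
      using R.dist_triangle[OF c(2) x c(1)] R.dist_sym[OF c(1) x] elim by simp
  qed
  then have "\<forall>\<^sub>F t in at_top_in T. d (word_prod G (\<lambda>r. \<lfloor>t * r\<rfloor>) x) (free_proj G (w t)) / t < e"
    using eventually_at_top_in_mem[of T]
  proof eventually_elim
    case (elim t)
    then show ?case
      using dist_free_proj_le[OF v[of t] dir_group_memD(1)[OF w elim(2)] scaling_set_pos[OF T elim(2)]]
        free_proj_int_word[OF carrier_letters[OF x]] by simp
  qed
  with x close show ?thesis using that by blast
qed

text \<open>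
  At times in \<open>T\<close> the given path is kept. At the other times a value is chosen that is, after
  rescaling, asymptotically as close as possible to the tail of the path; rounded words show that the
  achievable distance tends to 0.
\<close>
lemma dir_group_extend:
  assumes T: "scaling_set T" "scaling_set T'" "T \<subseteq> T'" and w: "w \<in> carrier (dir_group G N T)"
  obtains w' where "w' \<in> carrier (dir_group G N T')" "restrict w' T = w"
proof -
  define P where "P v t \<epsilon> \<longleftrightarrow> v \<in> carrier (FZ G) \<and>
    (\<forall>\<^sub>F \<tau> in at_top_in T. dR (psi G (1 / t) v) (psi G (1 / \<tau>) (w \<tau>)) < \<epsilon>)" for v t \<epsilon>
  have mono: "P v t \<epsilon>'" if "P v t \<epsilon>" "\<epsilon> \<le> \<epsilon>'" for v t \<epsilon> \<epsilon>'
    using that unfolding P_def by (auto elim: eventually_mono)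
  have wP: "\<forall>\<^sub>F t in at_top_in T'. t \<in> T \<longrightarrow> P (w t) t \<epsilon>" if e: "0 < \<epsilon>" for \<epsilon>
  proof -
    obtain s where s: "\<forall>t\<in>T. \<forall>t'\<in>T. s \<le> t \<and> s \<le> t' \<longrightarrow>
        dR (psi G (1 / t) (w t)) (psi G (1 / t') (w t')) < \<epsilon>"
      using dir_group_memD(3)[OF w] e unfolding cauchy_along_def by blast
    then show ?thesis
      unfolding P_def eventually_at_top_in using dir_group_memD(1)[OF w] by blast
  qed
  have ex: "\<forall>\<^sub>F t in at_top_in T'. \<exists>v. P v t \<epsilon>" if e: "0 < \<epsilon>" for \<epsilon>
  proof -
    obtain x where x: "x \<in> carrier (FR G)"
      and wx: "\<forall>\<^sub>F t in at_top_in T. dR (psi G (1 / t) (w t)) x < \<epsilon> / 2"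
      using dir_group_approx[OF T(1) w, of "\<epsilon> / 2"] e by auto
    let ?v = "\<lambda>t. int_word (\<lambda>r. \<lfloor>t * r\<rfloor>) x"
    have v: "?v t \<in> carrier (FZ G)" for t
      using carrier_letters[OF x] by (rule int_word_FZ)
    have "\<forall>\<^sub>F t in at_top_in T'. dR (psi G (1 / t) (?v t)) x < \<epsilon> / 2"
      using order_tendstoD(2)[OF tends_in_floor_word[OF x, unfolded tends_in_def], of "\<epsilon> / 2"] e
      by simp
    then show ?thesis
    proof eventually_elim
      case (elim t)
      have "\<forall>\<^sub>F \<tau> in at_top_in T. dR (psi G (1 / t) (?v t)) (psi G (1 / \<tau>) (w \<tau>)) < \<epsilon>"
        using wx eventually_at_top_in_mem[of T]
      proof eventually_elim
        case (elim \<tau>)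
        have c: "psi G (1 / \<tau>) (w \<tau>) \<in> carrier (FR G)" "psi G (1 / t) (?v t) \<in> carrier (FR G)"
          using dir_group_memD(1)[OF w elim(2)] v by (auto intro: psi_FZ_closed)
        show ?case
          using R.dist_triangle[OF c(2) x c(1)] R.dist_sym[OF c(1) x] elim(1)
            \<open>dR (psi G (1 / t) (?v t)) x < \<epsilon> / 2\<close> by simp
      qed
      then show ?case using v unfolding P_def by blast
    qed
  qed
  obtain v where v: "\<And>\<epsilon>. 0 < \<epsilon> \<Longrightarrow> \<forall>\<^sub>F t in at_top_in T'. P (v t) t \<epsilon>"
  proof (rule eventual_selection[of T' P])
    show "scaling_set T'" by fact
    show "P v t \<epsilon>'" if "P v t \<epsilon>" "\<epsilon> \<le> \<epsilon>'" for v t \<epsilon> \<epsilon>'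
      using that by (rule mono)
    show "\<forall>\<^sub>F t in at_top_in T'. \<exists>v. P v t \<epsilon>" if "0 < \<epsilon>" for \<epsilon>
      using that by (rule ex)
  qed blast
  \<comment> \<open>The last alternative only concerns early times, at which \<open>v t\<close> is arbitrary.\<close>
  define w' where "w' t = (if t \<in> T then w t else if v t \<in> carrier (FZ G) then v t else \<one>\<^bsub>FR G\<^esub>)" for t
  have w'FZ: "w' t \<in> carrier (FZ G)" for t
    using dir_group_memD(1)[OF w] subgroup.one_closed[OF subgroup_FZ] by (auto simp: w'_def)
  have w'P: "\<forall>\<^sub>F t in at_top_in T'. P (w' t) t \<epsilon>" if "0 < \<epsilon>" for \<epsilon>
    using wP[OF that] v[OF that] by eventually_elim (auto simp: w'_def P_def)
  have "cauchy_along T' dR (\<lambda>t. psi G (1 / t) (w' t))"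
    unfolding cauchy_along_def
  proof (intro allI impI)
    fix e :: real assume "0 < e"
    then obtain s where s: "\<forall>t\<in>T'. s \<le> t \<longrightarrow> P (w' t) t (e / 2)"
      using w'P[of "e / 2"] unfolding eventually_at_top_in by auto
    show "\<exists>s. \<forall>t\<in>T'. \<forall>t'\<in>T'. s \<le> t \<and> s \<le> t' \<longrightarrow> dR (psi G (1 / t) (w' t)) (psi G (1 / t') (w' t')) < e"
    proof (intro exI[of _ s] ballI impI)
      fix t t' assume t: "t \<in> T'" "t' \<in> T'" "s \<le> t \<and> s \<le> t'"
      let ?d = "\<lambda>t \<tau>. dR (psi G (1 / t) (w' t)) (psi G (1 / \<tau>) (w \<tau>))"
      have "\<forall>\<^sub>F \<tau> in at_top_in T. ?d t \<tau> < e / 2 \<and> ?d t' \<tau> < e / 2 \<and> \<tau> \<in> T"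
        using s t eventually_at_top_in_mem[of T] by (auto simp: P_def eventually_conj_iff)
      then obtain \<tau> where \<tau>: "?d t \<tau> < e / 2" "?d t' \<tau> < e / 2" "\<tau> \<in> T"
        using eventually_happens'[OF at_top_in_neq_bot[OF T(1)]] by blast
      have c: "psi G (1 / \<tau>) (w \<tau>) \<in> carrier (FR G)" "psi G (1 / t) (w' t) \<in> carrier (FR G)" for t
        using dir_group_memD(1)[OF w \<tau>(3)] w'FZ by (auto intro: psi_FZ_closed)
      show "dR (psi G (1 / t) (w' t)) (psi G (1 / t') (w' t')) < e"
        using R.dist_triangle[OF c(2)[of t] c(1) c(2)[of t']] R.dist_sym[OF c(2)[of t'] c(1)] \<tau> by simp
    qed
  qed
  then have "restrict w' T' \<in> carrier (dir_group G N T')"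
    using w'FZ by (simp add: dir_group_def cauchy_along_def)
  moreover have "restrict (restrict w' T') T = w"
    using dir_group_memD(2)[OF w] T(3) by (auto simp: fun_eq_iff w'_def PiE_def extensional_def)
  ultimately show ?thesis using that by blast
qed

lemma dir_group_restrict:
  assumes "T \<subseteq> T'" and w: "w \<in> carrier (dir_group G N T')"
  shows "restrict w T \<in> carrier (dir_group G N T)"
proof -
  have "cauchy_along T dR (\<lambda>t. psi G (1 / t) (restrict w T t))"
    using dir_group_memD(3)[OF w] assms(1) unfolding cauchy_along_def
    by (simp add: subset_iff) blast
  then show ?thesis
    using dir_group_memD(1)[OF w] assms(1) by (auto simp: dir_group_def)
qed

lemma fun_group_restrict:
  assumes T: "T \<subseteq> T'" and g: "g \<in> carrier (fun_group G N T')"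
  shows "restrict g T \<in> carrier (fun_group G N T)"
proof -
  obtain w where w: "w \<in> carrier (dir_group G N T')" "g = (\<lambda>t\<in>T'. free_proj G (w t))"
    using g by (rule fun_group_memE)
  have "restrict g T = (\<lambda>t\<in>T. free_proj G (restrict w T t))"
    using w T by (auto simp: fun_eq_iff)
  then show ?thesis using fun_group_memI[OF dir_group_restrict[OF T w(1)]] by simp
qed

lemma fun_group_extend:
  assumes T: "scaling_set T" "scaling_set T'" "T \<subseteq> T'" and g: "g \<in> carrier (fun_group G N T)"
  obtains g' where "g' \<in> carrier (fun_group G N T')" "restrict g' T = g"
proof -
  obtain w where w: "w \<in> carrier (dir_group G N T)" "g = (\<lambda>t\<in>T. free_proj G (w t))"
    using g by (rule fun_group_memE)
  obtain w' where w': "w' \<in> carrier (dir_group G N T')" "restrict w' T = w"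
    using dir_group_extend[OF T w(1)] .
  have "restrict (\<lambda>t\<in>T'. free_proj G (w' t)) T = g"
    using T(3) w(2) by (auto simp: fun_eq_iff w'(2)[symmetric])
  then show ?thesis using that[OF fun_group_memI[OF w'(1)]] by blast
qed

end

section \<open>The norm as a growth rate\<close>

context lbc_normed_group
begin

text \<open>
  Both inequalities of the limit formula. For the lower one let \<open>p\<close> be a path of rounded words close
  to \<open>g\<close>. A lift of \<open>p\<close> that is adapted to the time \<open>s\<close> is corrected by the small element \<open>z\<close> to a
  lift of \<open>g\<close>. Reading the resulting estimate \<open>key\<close> at \<open>s = t\<close> bounds \<open>N (p t) / t\<close>, and with it
  \<open>N (g t) / t\<close>, from below.
\<close>
lemma fun_norm_tendsto:
  assumes T: "scaling_set T" and g: "g \<in> carrier (fun_group G N T)"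
  shows "((\<lambda>t. N (g t) / t) \<longlongrightarrow> fun_norm G N T g) (at_top_in T)"
proof -
  let ?S = "{dir_norm G N T w | w. w \<in> carrier (dir_group G N T) \<and> (\<lambda>t\<in>T. free_proj G (w t)) = g}"
  have fun_norm: "fun_norm G N T g = Inf ?S" by (simp add: fun_norm_def)
  obtain w where w: "w \<in> carrier (dir_group G N T)" and gw: "g = (\<lambda>t\<in>T. free_proj G (w t))"
    using g by (rule fun_group_memE)
  have ne: "?S \<noteq> {}" using w gw by auto
  have bdd: "bdd_below ?S" using dir_norm_nonneg[OF T] by (intro bdd_belowI[of _ 0]) auto
  have upper: "\<forall>\<^sub>F t in at_top_in T. N (g t) / t < a" if a: "fun_norm G N T g < a" for a
  proof -
    obtain v where v: "v \<in> carrier (dir_group G N T)" "(\<lambda>t\<in>T. free_proj G (v t)) = g"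
      "dir_norm G N T v < a"
      using cInf_lessD[OF ne a[unfolded fun_norm]] by blast
    have "\<forall>\<^sub>F t in at_top_in T. free_norm G N (psi G (1 / t) (v t)) < a"
      using order_tendstoD(2)[OF dir_norm_tendsto[OF T v(1)] v(3)] .
    then show ?thesis
      using eventually_at_top_in_mem[of T]
    proof eventually_elim
      case (elim t)
      have "g t = free_proj G (v t)" using v(2) elim(2) by auto
      then show ?case
        using norm_free_proj_le[OF dir_group_memD(1)[OF v(1) elim(2)] scaling_set_pos[OF T elim(2)]]
          elim(1) by simp
    qed
  qed
  have lower: "\<forall>\<^sub>F t in at_top_in T. a < N (g t) / t" if a: "a < fun_norm G N T g" for a
  proof -
    \<comment> \<open>One \<open>e\<close> each for the norm of \<open>z\<close>, for the term \<open>K / t\<close>, and for the distance of \<open>p t\<close> and \<open>g t\<close>.\<close>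
    define e where "e = (fun_norm G N T g - a) / 3"
    have e: "0 < e" using a by (simp add: e_def)
    obtain x where x: "x \<in> carrier (FR G)"
      and vw: "\<forall>\<^sub>F t in at_top_in T. dR (psi G (1 / t) (int_word (\<lambda>r. \<lfloor>t * r\<rfloor>) x)) (psi G (1 / t) (w t)) < e"
      and pg: "\<forall>\<^sub>F t in at_top_in T. d (word_prod G (\<lambda>r. \<lfloor>t * r\<rfloor>) x) (free_proj G (w t)) / t < e"
      using dir_group_approx_floor[OF T w e] .
    note xc = carrier_letters[OF x]
    let ?p = "\<lambda>t. word_prod G (\<lambda>r. \<lfloor>t * r\<rfloor>) x"
    define v where "v = (\<lambda>t\<in>T. int_word (\<lambda>r. \<lfloor>t * r\<rfloor>) x)"
    define K where "K = (\<Sum>(g, r)\<leftarrow>x. N g)"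
    have v: "v \<in> carrier (dir_group G N T)"
      unfolding v_def
      by (rule tends_in_dir_group(1)[OF T _ x tends_in_floor_word[OF x]]) (rule int_word_FZ[OF xc])
    define z where "z = (\<lambda>t\<in>T. inv\<^bsub>FR G\<^esub> v t \<otimes>\<^bsub>FR G\<^esub> w t)"
    have z: "z \<in> carrier (dir_group G N T)"
      using dir_group_mult[OF dir_group_inv[OF v] w] by (simp add: z_def cong: restrict_cong)
    have "dir_norm G N T z \<le> e"
    proof (rule tendsto_upperbound[OF dir_norm_tendsto[OF T z] _ at_top_in_neq_bot[OF T]])
      show "\<forall>\<^sub>F t in at_top_in T. free_norm G N (psi G (1 / t) (z t)) \<le> e"
        using vw eventually_at_top_in_mem[of T]
      proof eventually_elim
        case (elim t)
        then show ?case
          using dir_group_memD(1)[OF v elim(2)] dir_group_memD(1)[OF w elim(2)]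
          by (simp add: z_def v_def norm_dist_def psi_mult psi_inv FZ_subset)
      qed
    qed
    have key: "fun_norm G N T g \<le> N (?p s) / s + K / s + e" if s: "0 < s" for s
    proof -
      obtain u where u: "u \<in> carrier (dir_group G N T)"
        "\<And>t. t \<in> T \<Longrightarrow> free_proj G (u t) = ?p t"
        "dir_norm G N T u \<le> N (?p s) / s + K / s"
        using lift_int_words[OF T xc s] unfolding K_def by blast
      let ?u = "\<lambda>t\<in>T. u t \<otimes>\<^bsub>FR G\<^esub> z t"
      have uz: "?u \<in> carrier (dir_group G N T)" by (rule dir_group_mult[OF u(1) z])
      have "free_proj G (?u t) = g t" if t: "t \<in> T" for t
      proof -
        have "free_proj G (?u t) = ?p t \<otimes> (inv ?p t \<otimes> free_proj G (w t))"
          using t u(2) dir_group_memD(1)[OF u(1) t] dir_group_memD(1)[OF v t]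
            dir_group_memD(1)[OF w t] free_proj_int_word[OF xc]
          by (simp add: z_def free_proj_mult free_proj_inv FZ_mult_closed FZ_inv_closed)
             (simp add: v_def)
        then show ?thesis
          using t xc dir_group_memD(1)[OF w t] by (simp add: gw mult_inv_cancel free_proj_closed)
      qed
      then have "(\<lambda>t\<in>T. free_proj G (?u t)) = g"
        using fun_group_carrier[OF T g] by (auto simp: fun_eq_iff PiE_def extensional_def)
      then have "fun_norm G N T g \<le> dir_norm G N T ?u"
        unfolding fun_norm using uz by (intro cInf_lower bdd) blast
      also have "\<dots> \<le> dir_norm G N T u + dir_norm G N T z"
      proof (rule tendsto_le[OF at_top_in_neq_bot[OF T]
            tendsto_add[OF dir_norm_tendsto[OF T u(1)] dir_norm_tendsto[OF T z]] dir_norm_tendsto[OF T uz]])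
        show "\<forall>\<^sub>F t in at_top_in T. free_norm G N (psi G (1 / t) (?u t))
            \<le> free_norm G N (psi G (1 / t) (u t)) + free_norm G N (psi G (1 / t) (z t))"
          using eventually_at_top_in_mem[of T]
        proof eventually_elim
          case (elim t)
          then show ?case
            using dir_group_memD(1)[OF u(1) elim] dir_group_memD(1)[OF z elim]
            by (simp add: psi_mult FZ_subset psi_closed R.norm_mult)
        qed
      qed
      finally show ?thesis using u(3) \<open>dir_norm G N T z \<le> e\<close> by linarith
    qed
    have "\<forall>\<^sub>F t in at_top_in T. (\<bar>K\<bar> + 1) / e \<le> t"
      unfolding eventually_at_top_in by auto
    with pg show ?thesis
      using eventually_at_top_in_mem[of T]
    proof eventually_elim
      case (elim t)
      have t: "0 < t" using scaling_set_pos[OF T elim(3)] .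
      have gt: "g t = free_proj G (w t)" "g t \<in> carrier G"
        using fun_group_closed[OF T g elim(3)] elim(3) gw by auto
      have "N (?p t) \<le> N (g t) + d (?p t) (g t)"
        using norm_diff_dist[of "?p t" "g t"] xc gt(2) by auto
      then have "N (?p t) / t \<le> N (g t) / t + d (?p t) (g t) / t"
        using t by (simp add: field_simps)
      moreover have "K / t < e"
      proof -
        have "K < \<bar>K\<bar> + 1" by simp
        also have "\<dots> \<le> t * e" using elim(2) e by (simp add: field_simps)
        finally show ?thesis using t by (simp add: field_simps)
      qed
      ultimately have "fun_norm G N T g < N (g t) / t + 3 * e"
        using key[OF t] elim(1) gt(1) by simp
      moreover have "3 * e = fun_norm G N T g - a" by (simp add: e_def)
      ultimately show ?case by linarith
    qed
  qed
  show ?thesis by (rule order_tendstoI) (use lower upper in auto)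
qed

text \<open>
  Replacing \<open>g\<close> and \<open>h\<close> by nearby paths of rounded words changes both products by a small multiple of
  \<open>t\<close>, and the commutators of the rounded paths lie in a bounded set \<open>[H, H]\<close>.
\<close>
lemma commutator_negligible:
  assumes T: "scaling_set T" and g: "g \<in> carrier (fun_group G N T)" and h: "h \<in> carrier (fun_group G N T)"
  shows "((\<lambda>t. d (g t \<otimes> h t) (h t \<otimes> g t) / t) \<longlongrightarrow> 0) (at_top_in T)"
proof (rule tendstoI)
  fix \<epsilon> :: real assume "0 < \<epsilon>"
  \<comment> \<open>Twice each for replacing \<open>g\<close> and \<open>h\<close>, and once for the bounded commutator.\<close>
  define e where "e = \<epsilon> / 5"
  have e: "0 < e" using \<open>0 < \<epsilon>\<close> by (simp add: e_def)
  obtain u v where u: "u \<in> carrier (dir_group G N T)" "g = (\<lambda>t\<in>T. free_proj G (u t))"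
    and v: "v \<in> carrier (dir_group G N T)" "h = (\<lambda>t\<in>T. free_proj G (v t))"
    using g h by (auto elim!: fun_group_memE)
  obtain x where x: "x \<in> carrier (FR G)"
    and pg: "\<forall>\<^sub>F t in at_top_in T. d (word_prod G (\<lambda>r. \<lfloor>t * r\<rfloor>) x) (free_proj G (u t)) / t < e"
    using dir_group_approx_floor[OF T u(1) e] .
  obtain y where y: "y \<in> carrier (FR G)"
    and qh: "\<forall>\<^sub>F t in at_top_in T. d (word_prod G (\<lambda>r. \<lfloor>t * r\<rfloor>) y) (free_proj G (v t)) / t < e"
    using dir_group_approx_floor[OF T v(1) e] .
  note xc = carrier_letters[OF x] and yc = carrier_letters[OF y]
  let ?p = "\<lambda>t. word_prod G (\<lambda>r. \<lfloor>t * r\<rfloor>) x" and ?q = "\<lambda>t. word_prod G (\<lambda>r. \<lfloor>t * r\<rfloor>) y"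
  define S where "S = fst ` (set x \<union> set y)"
  have S: "S \<subseteq> carrier G" "finite S" using xc yc by (auto simp: S_def)
  have H: "subgroup (generate G S) G" by (rule generate_is_subgroup[OF S(1)])
  obtain B where B: "\<And>u. u \<in> derived G (generate G S) \<Longrightarrow> N u \<le> B"
    using derived_generate_bound[OF S(2,1)] by blast
  have word: "word_prod G m w \<in> generate G S" if "set w \<subseteq> S \<times> UNIV" for m w
    using that
  proof (induction w)
    case (Cons a w)
    then show ?case
      using subgroup_int_pow_closed[OF H, of "fst a"]
      by (cases a) (auto intro!: generate.eng intro: generate.incl)
  qed (simp add: generate.one)
  have pq: "?p t \<in> generate G S" "?q t \<in> generate G S" for t
    by (rule word; force simp: S_def)+
  have [simp]: "?p t \<in> carrier G" "?q t \<in> carrier G" for t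
    using xc yc by auto
  have comm: "d (?p t \<otimes> ?q t) (?q t \<otimes> ?p t) \<le> B" for t
  proof -
    let ?a = "inv ?q t" and ?b = "inv ?p t"
    have "?a \<otimes> ?b \<otimes> inv ?a \<otimes> inv ?b \<in> derived G (generate G S)"
      unfolding derived_def using subgroup.m_inv_closed[OF H] pq by (intro generate.incl) blast
    moreover have "inv (?p t \<otimes> ?q t) \<otimes> (?q t \<otimes> ?p t) = ?a \<otimes> ?b \<otimes> inv ?a \<otimes> inv ?b"
      by (simp add: inv_mult_group m_assoc)
    ultimately show ?thesis unfolding norm_dist_def using B by simp
  qed
  have "\<forall>\<^sub>F t in at_top_in T. (\<bar>B\<bar> + 1) / e \<le> t"
    unfolding eventually_at_top_in by auto
  with pg qh show "\<forall>\<^sub>F t in at_top_in T. dist (d (g t \<otimes> h t) (h t \<otimes> g t) / t) 0 < \<epsilon>"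
    using eventually_at_top_in_mem[of T]
  proof eventually_elim
    case (elim t)
    have t: "0 < t" using scaling_set_pos[OF T elim(4)] .
    have gh: "g t = free_proj G (u t)" "h t = free_proj G (v t)"
      and [simp]: "g t \<in> carrier G" "h t \<in> carrier G"
      using u v elim(4) fun_group_closed[OF T g elim(4)] fun_group_closed[OF T h elim(4)] by auto
    have "B < \<bar>B\<bar> + 1" by simp
    also have "\<dots> \<le> t * e" using elim(3) e by (simp add: field_simps)
    finally have B: "B < t * e" .
    have pg: "d (?p t) (g t) < t * e" and qh: "d (?q t) (h t) < t * e"
      using elim(1,2) t by (simp_all add: gh field_simps)
    have "d (g t \<otimes> h t) (h t \<otimes> g t) \<le> d (g t \<otimes> h t) (?p t \<otimes> ?q t) + d (?p t \<otimes> ?q t) (h t \<otimes> g t)"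
      by (intro dist_triangle) auto
    also have "d (?p t \<otimes> ?q t) (h t \<otimes> g t)
        \<le> d (?p t \<otimes> ?q t) (?q t \<otimes> ?p t) + d (?q t \<otimes> ?p t) (h t \<otimes> g t)"
      by (intro dist_triangle) auto
    also have "d (g t \<otimes> h t) (?p t \<otimes> ?q t) \<le> d (?p t) (g t) + d (?q t) (h t)"
      using dist_mult[of "g t" "h t" "?p t" "?q t"] by (simp add: dist_sym)
    also have "d (?q t \<otimes> ?p t) (h t \<otimes> g t) \<le> d (?q t) (h t) + d (?p t) (g t)"
      by (intro dist_mult) auto
    finally have "d (g t \<otimes> h t) (h t \<otimes> g t) < t * \<epsilon>"
      using comm[of t] pg qh B by (simp add: e_def)
    then show ?case
      using t dist_nonneg[of "g t \<otimes> h t" "h t \<otimes> g t"] by (simp add: field_simps)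
  qed
qed

end

section \<open>The cone\<close>

context lbc_normed_group
begin

text \<open>
  By the limit formula, being null is a statement about the growth of \<open>N (g t)\<close>, so the subgroup and
  normality conditions can be checked pointwise in \<open>t\<close>.
\<close>
lemma null_subgroup_iff:
  assumes T: "scaling_set T"
  shows "g \<in> null_subgroup G N T \<longleftrightarrow>
    g \<in> carrier (fun_group G N T) \<and> ((\<lambda>t. N (g t) / t) \<longlongrightarrow> 0) (at_top_in T)"
  using fun_norm_tendsto[OF T, of g] tendsto_unique[OF at_top_in_neq_bot[OF T]]
  by (auto simp: null_subgroup_def)

lemma null_subgroup_squeeze:
  assumes T: "scaling_set T" and g: "g \<in> carrier (fun_group G N T)"
    and le: "\<And>t. t \<in> T \<Longrightarrow> N (g t) \<le> f t"
    and f: "((\<lambda>t. f t / t) \<longlongrightarrow> 0) (at_top_in T)"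
  shows "g \<in> null_subgroup G N T"
  unfolding null_subgroup_iff[OF T]
proof (intro conjI g tendsto_sandwich[OF _ _ tendsto_const f])
  have "0 \<le> N (g t) / t" "N (g t) / t \<le> f t / t" if "t \<in> T" for t
    using scaling_set_pos[OF T that] le[OF that] norm_nonneg[OF fun_group_closed[OF T g that]]
    by (simp_all add: divide_right_mono)
  then show "\<forall>\<^sub>F t in at_top_in T. 0 \<le> N (g t) / t" "\<forall>\<^sub>F t in at_top_in T. N (g t) / t \<le> f t / t"
    using eventually_at_top_in_mem[of T] by (auto elim: eventually_mono)
qed

lemma null_subgroup_normal:
  assumes T: "scaling_set T" shows "null_subgroup G N T \<lhd> fun_group G N T"
proof -
  interpret F: group "fun_group G N T" by (rule group_fun_group[OF T])
  note cl = fun_group_closed[OF T]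
  show ?thesis
    unfolding F.normal_inv_iff
  proof (intro conjI ballI F.subgroupI)
    show "null_subgroup G N T \<subseteq> carrier (fun_group G N T)"
      by (auto simp: null_subgroup_def)
    have "\<one>\<^bsub>fun_group G N T\<^esub> \<in> null_subgroup G N T"
      using F.one_closed
      by (intro null_subgroup_squeeze[OF T, where f = "\<lambda>_. 0"]) (auto simp: one_fun_group norm_one)
    then show "null_subgroup G N T \<noteq> {}" by blast
    fix a assume "a \<in> null_subgroup G N T"
    then have a: "a \<in> carrier (fun_group G N T)" "((\<lambda>t. N (a t) / t) \<longlongrightarrow> 0) (at_top_in T)"
      by (auto simp: null_subgroup_iff[OF T])
    show "inv\<^bsub>fun_group G N T\<^esub> a \<in> null_subgroup G N T"
      by (rule null_subgroup_squeeze[OF T _ _ a(2)])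
         (use a in \<open>auto simp: inv_fun_group[OF T] norm_inv cl\<close>, use F.inv_closed[OF a(1)] in \<open>simp add: inv_fun_group[OF T a(1)]\<close>)
    show "g \<otimes>\<^bsub>fun_group G N T\<^esub> a \<otimes>\<^bsub>fun_group G N T\<^esub> inv\<^bsub>fun_group G N T\<^esub> g \<in> null_subgroup G N T"
      if g: "g \<in> carrier (fun_group G N T)" for g
    proof (rule null_subgroup_squeeze[OF T _ _ a(2)])
      show "g \<otimes>\<^bsub>fun_group G N T\<^esub> a \<otimes>\<^bsub>fun_group G N T\<^esub> inv\<^bsub>fun_group G N T\<^esub> g \<in> carrier (fun_group G N T)"
        using a g by simp
      show "N ((g \<otimes>\<^bsub>fun_group G N T\<^esub> a \<otimes>\<^bsub>fun_group G N T\<^esub> inv\<^bsub>fun_group G N T\<^esub> g) t) \<le> N (a t)"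
        if "t \<in> T" for t
        using that by (simp add: mult_fun_group inv_fun_group[OF T g] norm_conj cl[OF g] cl[OF a(1)])
    qed
    fix b assume "b \<in> null_subgroup G N T"
    then have b: "b \<in> carrier (fun_group G N T)" "((\<lambda>t. N (b t) / t) \<longlongrightarrow> 0) (at_top_in T)"
      by (auto simp: null_subgroup_iff[OF T])
    show "a \<otimes>\<^bsub>fun_group G N T\<^esub> b \<in> null_subgroup G N T"
    proof (rule null_subgroup_squeeze[OF T])
      show "a \<otimes>\<^bsub>fun_group G N T\<^esub> b \<in> carrier (fun_group G N T)" using a b by simp
      show "N ((a \<otimes>\<^bsub>fun_group G N T\<^esub> b) t) \<le> N (a t) + N (b t)" if "t \<in> T" for t
        using that by (simp add: mult_fun_group norm_mult cl[OF b(1)] cl[OF a(1)])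
      show "((\<lambda>t. (N (a t) + N (b t)) / t) \<longlongrightarrow> 0) (at_top_in T)"
        using tendsto_add_zero[OF a(2) b(2)] by (simp add: add_divide_distrib)
    qed
  qed
qed

text \<open>
  The norm is constant on the cosets of the null subgroup, so that \<open>the_elem\<close> in \<open>cone_norm\<close> selects it.
\<close>
lemma fun_norm_mult_null:
  assumes T: "scaling_set T" and n: "n \<in> null_subgroup G N T" and g: "g \<in> carrier (fun_group G N T)"
  shows "fun_norm G N T (n \<otimes>\<^bsub>fun_group G N T\<^esub> g) = fun_norm G N T g"
proof -
  interpret F: group "fun_group G N T" by (rule group_fun_group[OF T])
  have n': "n \<in> carrier (fun_group G N T)" "((\<lambda>t. N (n t) / t) \<longlongrightarrow> 0) (at_top_in T)"
    using n by (auto simp: null_subgroup_iff[OF T])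
  let ?h = "n \<otimes>\<^bsub>fun_group G N T\<^esub> g"
  have h: "?h \<in> carrier (fun_group G N T)" using n' g by simp
  have le: "\<bar>N (?h t) / t - N (g t) / t\<bar> \<le> N (n t) / t" if t: "t \<in> T" for t
  proof -
    have [simp]: "n t \<in> carrier G" "g t \<in> carrier G"
      using fun_group_closed[OF T _ t] n' g by auto
    have "\<bar>N (g t) - N (n t \<otimes> g t)\<bar> \<le> d (g t) (n t \<otimes> g t)"
      by (rule norm_diff_dist) auto
    also have "\<dots> = N (n t)"
      using norm_conj'[of "n t" "g t"] by (simp add: norm_dist_def m_assoc)
    finally have "\<bar>N (?h t) - N (g t)\<bar> / t \<le> N (n t) / t"
      using t scaling_set_pos[OF T t]
      by (simp add: mult_fun_group abs_minus_commute divide_right_mono)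
    moreover have "\<bar>N (?h t) / t - N (g t) / t\<bar> = \<bar>N (?h t) - N (g t)\<bar> / t"
      using scaling_set_pos[OF T t] by (simp flip: diff_divide_distrib)
    ultimately show ?thesis by simp
  qed
  have "((\<lambda>t. N (?h t) / t - N (g t) / t) \<longlongrightarrow> 0) (at_top_in T)"
  proof (rule tendsto_0_le[OF n'(2)])
    show "\<forall>\<^sub>F t in at_top_in T. norm (N (?h t) / t - N (g t) / t) \<le> norm (N (n t) / t) * 1"
      using eventually_at_top_in_mem[of T]
    proof eventually_elim
      case (elim t)
      show ?case using le[OF elim] unfolding real_norm_def mult_1_right by (rule order_trans) (rule abs_ge_self)
    qed
  qed
  from tendsto_add[OF this fun_norm_tendsto[OF T g]]
  have "((\<lambda>t. N (?h t) / t) \<longlongrightarrow> fun_norm G N T g) (at_top_in T)" by simp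
  then show ?thesis
    using tendsto_unique[OF at_top_in_neq_bot[OF T] fun_norm_tendsto[OF T h]] by simp
qed

lemma cone_class_eq_image:
  "cone_class G N T g = (\<lambda>n. n \<otimes>\<^bsub>fun_group G N T\<^esub> g) ` null_subgroup G N T"
  by (auto simp: cone_class_def r_coset_def)

lemma null_subgroup_nonempty: "scaling_set T \<Longrightarrow> null_subgroup G N T \<noteq> {}"
  using subgroup.one_closed[OF normal_imp_subgroup[OF null_subgroup_normal]] by blast

lemma cone_norm_class:
  assumes T: "scaling_set T" and g: "g \<in> carrier (fun_group G N T)"
  shows "cone_norm G N T (cone_class G N T g) = fun_norm G N T g"
proof -
  have "fun_norm G N T ` cone_class G N T g = {fun_norm G N T g}"
    unfolding cone_class_eq_image
    using null_subgroup_nonempty[OF T] fun_norm_mult_null[OF T _ g]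
    by (simp add: image_image image_constant_conv cong: image_cong)
  then show ?thesis by (simp add: cone_norm_def)
qed

lemma carrier_dir_cone: "carrier (dir_cone G N T) = cone_class G N T ` carrier (fun_group G N T)"
  by (auto simp: dir_cone_def FactGroup_def RCOSETS_def cone_class_def)

lemma group_dir_cone: "scaling_set T \<Longrightarrow> group (dir_cone G N T)"
  unfolding dir_cone_def by (rule normal.factorgroup_is_group[OF null_subgroup_normal])

lemma cone_class_hom:
  assumes T: "scaling_set T"
  shows "group_hom (fun_group G N T) (dir_cone G N T) (cone_class G N T)"
proof -
  have "cone_class G N T = (\<lambda>g. null_subgroup G N T #>\<^bsub>fun_group G N T\<^esub> g)"
    by (simp add: fun_eq_iff cone_class_def)
  then show ?thesis
    using normal.r_coset_hom_Mod[OF null_subgroup_normal[OF T]] group_fun_group[OF T] group_dir_cone[OF T]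
    by (simp add: group_hom_def group_hom_axioms_def dir_cone_def)
qed

lemma cone_class_eqI:
  assumes T: "scaling_set T" and g: "g \<in> carrier (fun_group G N T)"
    and h: "h \<in> carrier (fun_group G N T)"
    and null: "h \<otimes>\<^bsub>fun_group G N T\<^esub> inv\<^bsub>fun_group G N T\<^esub> g \<in> null_subgroup G N T"
  shows "cone_class G N T g = cone_class G N T h"
proof -
  interpret F: group "fun_group G N T" by (rule group_fun_group[OF T])
  note sub = normal_imp_subgroup[OF null_subgroup_normal[OF T]]
  show ?thesis
    unfolding cone_class_def
    using subgroup.rcos_module_rev[OF sub F.is_group g h null] by (intro F.repr_independence g sub)
qed

lemma cone_class_eqD:
  assumes T: "scaling_set T" and g: "g \<in> carrier (fun_group G N T)"
    and h: "h \<in> carrier (fun_group G N T)" and eq: "cone_class G N T g = cone_class G N T h"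
  shows "h \<otimes>\<^bsub>fun_group G N T\<^esub> inv\<^bsub>fun_group G N T\<^esub> g \<in> null_subgroup G N T"
proof -
  interpret F: group "fun_group G N T" by (rule group_fun_group[OF T])
  note sub = normal_imp_subgroup[OF null_subgroup_normal[OF T]]
  show ?thesis
    using F.rcos_self[OF h sub] eq unfolding cone_class_def
    by (intro subgroup.rcos_module_imp[OF sub F.is_group g]) simp
qed

lemma dir_cone_comm:
  assumes T: "scaling_set T" shows "comm_group (dir_cone G N T)"
proof (rule group.group_comm_groupI[OF group_dir_cone[OF T]])
  interpret F: group "fun_group G N T" by (rule group_fun_group[OF T])
  interpret c: group_hom "fun_group G N T" "dir_cone G N T" "cone_class G N T"
    by (rule cone_class_hom[OF T])
  fix x y assume "x \<in> carrier (dir_cone G N T)" "y \<in> carrier (dir_cone G N T)"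
  then obtain g h where g: "g \<in> carrier (fun_group G N T)" "x = cone_class G N T g"
    and h: "h \<in> carrier (fun_group G N T)" "y = cone_class G N T h"
    by (auto simp: carrier_dir_cone)
  let ?gh = "g \<otimes>\<^bsub>fun_group G N T\<^esub> h" and ?hg = "h \<otimes>\<^bsub>fun_group G N T\<^esub> g"
  have "cone_class G N T ?gh = cone_class G N T ?hg"
  proof (intro cone_class_eqI[OF T] null_subgroup_squeeze[OF T _ _ commutator_negligible[OF T g(1) h(1)]])
    fix t assume t: "t \<in> T"
    have [simp]: "g t \<in> carrier G" "h t \<in> carrier G"
      using fun_group_closed[OF T _ t] g(1) h(1) by auto
    have "?gh \<in> carrier (fun_group G N T)" using g h by simp
    then have "(?hg \<otimes>\<^bsub>fun_group G N T\<^esub> inv\<^bsub>fun_group G N T\<^esub> ?gh) t = (h t \<otimes> g t) \<otimes> inv (g t \<otimes> h t)"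
      using t by (simp add: inv_fun_group[OF T]) (simp add: mult_fun_group)
    then show "N ((?hg \<otimes>\<^bsub>fun_group G N T\<^esub> inv\<^bsub>fun_group G N T\<^esub> ?gh) t) \<le> d (g t \<otimes> h t) (h t \<otimes> g t)"
      using dist_inv[of "h t \<otimes> g t" "g t \<otimes> h t"] dist_sym[of "h t \<otimes> g t" "g t \<otimes> h t"]
      by (simp add: norm_dist_def)
  qed (use g h in auto)
  then show "x \<otimes>\<^bsub>dir_cone G N T\<^esub> y = y \<otimes>\<^bsub>dir_cone G N T\<^esub> x"
    using g h by simp
qed

context
  fixes T T' assumes T: "scaling_set T" and T': "scaling_set T'" and sub: "T \<subseteq> T'"
begin

lemma fun_norm_restrict:
  assumes g: "g \<in> carrier (fun_group G N T')"
  shows "fun_norm G N T (restrict g T) = fun_norm G N T' g"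
proof -
  have "((\<lambda>t. N (g t) / t) \<longlongrightarrow> fun_norm G N T' g) (at_top_in T)"
    using fun_norm_tendsto[OF T' g] at_top_in_mono[OF sub] by (rule tendsto_mono[rotated])
  moreover have "((\<lambda>t. N (g t) / t) \<longlongrightarrow> fun_norm G N T (restrict g T)) (at_top_in T)"
  proof (rule Lim_transform_eventually[OF fun_norm_tendsto[OF T fun_group_restrict[OF sub g]]])
    show "\<forall>\<^sub>F t in at_top_in T. N (restrict g T t) / t = N (g t) / t"
      using eventually_at_top_in_mem[of T] by eventually_elim simp
  qed
  ultimately show ?thesis
    using tendsto_unique[OF at_top_in_neq_bot[OF T]] by blast
qed

lemma restrict_mult:
  "restrict (g \<otimes>\<^bsub>fun_group G N T'\<^esub> h) T = restrict g T \<otimes>\<^bsub>fun_group G N T\<^esub> restrict h T"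
  using sub by (auto simp: mult_fun_group fun_eq_iff)

lemma restrict_inv:
  assumes g: "g \<in> carrier (fun_group G N T')"
  shows "restrict (inv\<^bsub>fun_group G N T'\<^esub> g) T = inv\<^bsub>fun_group G N T\<^esub> restrict g T"
  using sub by (auto simp: inv_fun_group[OF T' g] inv_fun_group[OF T fun_group_restrict[OF sub g]] fun_eq_iff)

lemma restrict_null_iff:
  assumes "g \<in> carrier (fun_group G N T')"
  shows "restrict g T \<in> null_subgroup G N T \<longleftrightarrow> g \<in> null_subgroup G N T'"
  using assms fun_group_restrict[OF sub assms] fun_norm_restrict[OF assms]
  by (simp add: null_subgroup_def)

text \<open>
  Likewise all representatives of a class restrict to the same class, which \<open>the_elem\<close> in
  \<open>cone_restrict\<close> then selects.
\<close>
lemma cone_restrict_class: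
  assumes g: "g \<in> carrier (fun_group G N T')"
  shows "cone_restrict G N T (cone_class G N T' g) = cone_class G N T (restrict g T)"
proof -
  interpret F: group "fun_group G N T" by (rule group_fun_group[OF T])
  have "cone_class G N T (restrict (n \<otimes>\<^bsub>fun_group G N T'\<^esub> g) T) = cone_class G N T (restrict g T)"
    if n: "n \<in> null_subgroup G N T'" for n
  proof -
    have n': "n \<in> carrier (fun_group G N T')" using n by (simp add: null_subgroup_def)
    note c = fun_group_restrict[OF sub n'] fun_group_restrict[OF sub g]
    have "restrict n T \<in> null_subgroup G N T"
      using restrict_null_iff[OF n'] n by simp
    then show ?thesis
      unfolding restrict_mult using c
      by (intro cone_class_eqI[OF T, symmetric]) (simp_all add: F.m_assoc)
  qed
  then have "(\<lambda>h. cone_class G N T (restrict h T)) ` cone_class G N T' g = {cone_class G N T (restrict g T)}"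
    unfolding cone_class_eq_image[of T'] using null_subgroup_nonempty[OF T']
    by (simp add: image_image image_constant_conv cong: image_cong)
  then show ?thesis by (simp add: cone_restrict_def)
qed

lemma cone_restrict_isometry:
  "isometry_between
    (carrier (dir_cone G N T')) (norm_dist (dir_cone G N T') (cone_norm G N T'))
    (carrier (dir_cone G N T)) (norm_dist (dir_cone G N T) (cone_norm G N T))
    (cone_restrict G N T)"
proof -
  interpret F: group "fun_group G N T" by (rule group_fun_group[OF T])
  interpret F': group "fun_group G N T'" by (rule group_fun_group[OF T'])
  interpret c: group_hom "fun_group G N T" "dir_cone G N T" "cone_class G N T"
    by (rule cone_class_hom[OF T])
  interpret c': group_hom "fun_group G N T'" "dir_cone G N T'" "cone_class G N T'"
    by (rule cone_class_hom[OF T'])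
  have "inj_on (cone_restrict G N T) (carrier (dir_cone G N T'))"
  proof (rule inj_onI)
    fix x y assume "x \<in> carrier (dir_cone G N T')" "y \<in> carrier (dir_cone G N T')"
      and eq: "cone_restrict G N T x = cone_restrict G N T y"
    then obtain g h where g: "g \<in> carrier (fun_group G N T')" "x = cone_class G N T' g"
      and h: "h \<in> carrier (fun_group G N T')" "y = cone_class G N T' h"
      by (auto simp: carrier_dir_cone)
    note r = fun_group_restrict[OF sub g(1)] fun_group_restrict[OF sub h(1)]
    have "cone_class G N T (restrict g T) = cone_class G N T (restrict h T)"
      using eq g h by (simp add: cone_restrict_class)
    then have "restrict h T \<otimes>\<^bsub>fun_group G N T\<^esub> inv\<^bsub>fun_group G N T\<^esub> restrict g T \<in> null_subgroup G N T"
      by (rule cone_class_eqD[OF T r])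
    then have "h \<otimes>\<^bsub>fun_group G N T'\<^esub> inv\<^bsub>fun_group G N T'\<^esub> g \<in> null_subgroup G N T'"
      using restrict_null_iff[of "h \<otimes>\<^bsub>fun_group G N T'\<^esub> inv\<^bsub>fun_group G N T'\<^esub> g"] g h
      by (simp add: restrict_mult restrict_inv)
    then show "x = y"
      using cone_class_eqI[OF T' g(1) h(1)] g h by simp
  qed
  moreover have "cone_restrict G N T ` carrier (dir_cone G N T') = carrier (dir_cone G N T)"
  proof (intro equalityI subsetI)
    fix y assume "y \<in> cone_restrict G N T ` carrier (dir_cone G N T')"
    then show "y \<in> carrier (dir_cone G N T)"
      by (auto simp: carrier_dir_cone cone_restrict_class intro: fun_group_restrict[OF sub])
  next
    fix y assume "y \<in> carrier (dir_cone G N T)"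
    then obtain g where g: "g \<in> carrier (fun_group G N T)" "y = cone_class G N T g"
      by (auto simp: carrier_dir_cone)
    obtain g' where "g' \<in> carrier (fun_group G N T')" "restrict g' T = g"
      using fun_group_extend[OF T T' sub g(1)] .
    then show "y \<in> cone_restrict G N T ` carrier (dir_cone G N T')"
      using g by (auto simp: carrier_dir_cone cone_restrict_class image_image intro!: image_eqI[of _ _ g'])
  qed
  moreover have "norm_dist (dir_cone G N T) (cone_norm G N T) (cone_restrict G N T x) (cone_restrict G N T y)
      = norm_dist (dir_cone G N T') (cone_norm G N T') x y"
    if xy: "x \<in> carrier (dir_cone G N T')" "y \<in> carrier (dir_cone G N T')" for x y
  proof -
    obtain g where g: "g \<in> carrier (fun_group G N T')" "x = cone_class G N T' g"
      using xy(1) unfolding carrier_dir_cone by (rule imageE)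
    obtain h where h: "h \<in> carrier (fun_group G N T')" "y = cone_class G N T' h"
      using xy(2) unfolding carrier_dir_cone by (rule imageE)
    note r = fun_group_restrict[OF sub g(1)] fun_group_restrict[OF sub h(1)]
    let ?k = "inv\<^bsub>fun_group G N T'\<^esub> g \<otimes>\<^bsub>fun_group G N T'\<^esub> h"
    have k: "?k \<in> carrier (fun_group G N T')"
      using g(1) h(1) by (intro F'.m_closed F'.inv_closed)
    have restrict_k: "restrict ?k T = inv\<^bsub>fun_group G N T\<^esub> restrict g T \<otimes>\<^bsub>fun_group G N T\<^esub> restrict h T"
      by (simp only: restrict_mult restrict_inv[OF g(1)])
    have "norm_dist (dir_cone G N T) (cone_norm G N T) (cone_restrict G N T x) (cone_restrict G N T y)
        = cone_norm G N T (cone_class G N T (restrict ?k T))"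
      unfolding norm_dist_def g(2) h(2) restrict_k
      by (simp only: cone_restrict_class[OF g(1)] cone_restrict_class[OF h(1)]
          c.hom_mult[OF F.inv_closed[OF r(1)] r(2)] c.hom_inv[OF r(1)])
    also have "\<dots> = fun_norm G N T' ?k"
      using cone_norm_class[OF T fun_group_restrict[OF sub k]] fun_norm_restrict[OF k] by simp
    also have "\<dots> = norm_dist (dir_cone G N T') (cone_norm G N T') x y"
      unfolding norm_dist_def g(2) h(2) cone_norm_class[OF T' k, symmetric]
      by (simp only: c'.hom_mult[OF F'.inv_closed[OF g(1)] h(1)] c'.hom_inv[OF g(1)])
    finally show ?thesis .
  qed
  ultimately show ?thesis
    by (simp add: isometry_between_def bij_betw_def)
qed

end

end

theorem theorem8p10:
  fixes G :: "('a, 'b) monoid_scheme" and N :: "'a \<Rightarrow> real"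
  assumes "group G"
    and "group_norm G N"
    and "conj_invariant G N"
    and "locally_bounded_commutators G N"
  shows "independent_of_scaling G N \<and>
    (\<forall>g\<in>carrier (fun_group G N {0<..}).
       ((\<lambda>t. N (g t) / t) \<longlongrightarrow> cone_norm G N {0<..} (cone_class G N {0<..} g)) at_top) \<and>
    comm_group (dir_cone G N {0<..})"
proof -
  interpret lbc_normed_group G N
    using assms by (simp add: lbc_normed_group_def lbc_normed_group_axioms_def conj_normed_group_def
        conj_normed_group_axioms_def)
  have pos: "scaling_set {0<..}"
  proof -
    have "\<not> (\<forall>x\<in>{0<..}. x \<le> M)" for M :: real
      by (intro notI) (drule bspec[of _ _ "max 1 (M + 1)"], auto)
    then show ?thesis by (auto simp: scaling_set_def bdd_above_def)
  qed
  have filter: "at_top_in {0<..} = (at_top :: real filter)"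
    using eventually_gt_at_top[of "0::real"]
    by (simp add: at_top_in_def inf.absorb1 le_principal greaterThan_def)
  show ?thesis
    unfolding independent_of_scaling_def
    using cone_restrict_isometry dir_cone_comm[OF pos] fun_norm_tendsto[OF pos] cone_norm_class[OF pos]
    by (simp add: filter)
qed

end
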